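(* For any $d_0\ge1$, $C>1$, $\varepsilon>0$, there exist $T,N\ge1$ with the following property. Let $G$ be $GL(d_0,\mathbb R)$, $SL(d_0,\mathbb R)$ or (for $d_0$ even) $Sp(d_0,\mathbb R)$. Let $(A_i)_{i\in\mathbb Z}$ be a hyperbolic periodic cocycle in $G$ bounded by $C$, with period $\ell\ge T$, whose stable and unstable spaces are both nontrivial, and such that the splitting $E^s\oplus E^u$ defined by the stable and unstable eigenvalues is not an $N$-dominated splitting. Then there exists an $\varepsilon$-path of perturbations $(A_i(t))_{t\in[0,1]}$ in $G$ with period $\ell$ such that: - $\mathcal A(t):=A_\ell(t)\cdots A_1(t)$ is hyperbolic for each $t\in[0,1]$; - for some $j\in\{1,\dots,\ell\}$, the angle between the stable and unstable spaces $E^s_j,E^u_j$ of the cocycle $(A_i(1))$ is smaller than $\varepsilon$.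
   Context: Matrices carry the operator norm associated with the Euclidean norm. For a subgroup $G\subset GL(d_0,\mathbb R)$, a periodic cocycle in $G$ with period $\ell\ge1$ is the integer $\ell$ together with a sequence $(A_i)_{i\in\mathbb Z}$ in $G$ with $A_{i+\ell}=A_i$ for all $i$. It is hyperbolic if $A_\ell\cdots A_1$ has no eigenvalue on the unit circle, and bounded by $C>1$ if $\max(\|A_i\|,\|A_i^{-1}\|)\le C$ for all $i$. For a hyperbolic cocycle, $E^s_i$ (resp. $E^u_i$) is the sum of the generalized eigenspaces of $A_{i+\ell-1}\cdots A_i$ for the eigenvalues of modulus $<1$ (resp. $>1$); these satisfy $A_iE^{s/u}_i=E^{s/u}_{i+1}$. An invariant splitting $\mathbb R^{d_0}=E_i\oplus F_i$ ($A_iE_i=E_{i+1}$, $A_iF_i=F_{i+1}$, $E_i,F_i$ nontrivial) is $N$-dominated if for all $i\in\mathbb Z$, all $n\ge N$ and all unit vectors $u\in E_i$, $v\in F_i$, $\|A_{i+n-1}\cdots A_iu\|\le\frac12\|A_{i+n-1}\cdots A_iv\|$. Here $E=E^s$, $F=E^u$. The angle between two nontrivial subspaces is the infimum of the angles between nonzero vectors of the one and of the other. An $\varepsilon$-path of perturbations of $(A_i)$ is a family of periodic cocycles $(A_i(t))_{i\in\mathbb Z}$, $t\in[0,1]$, in $G$, continuous in $t$, with $A_i(0)=A_i$ and $\max\{\|A_i-A_i(t)\|,\|A_i^{-1}-A_i(t)^{-1}\|\}<\varepsilon$ for all $i$ and all $t\in[0,1]$. *)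

theory Defs
  imports "HOL-Analysis.Analysis"
begin

definition op_norm :: "real^'n^'n \<Rightarrow> real" where
  "op_norm M = onorm (\<lambda>x. M *v x)"

section \<open>The groups\<close>

definition GL :: "(real^'n^'n) set" where
  "GL = {M. invertible M}"

definition SL :: "(real^'n^'n) set" where
  "SL = {M. det M = 1}"

text \<open>A finite index type carries no preferred order, so the standard symplectic form is
  written relative to a numbering \<open>e\<close> of the coordinates by \<open>0, \<dots>, d - 1\<close>, where
  \<open>d = CARD('n)\<close> is even: it is the block matrix with rows \<open>(0, I)\<close> and \<open>(-I, 0)\<close>.\<close>

definition symplectic_form :: "('n \<Rightarrow> nat) \<Rightarrow> real^'n^'n" where
  "symplectic_form e = (\<chi> i j.
     if e j = e i + CARD('n) div 2 then 1
     else if e i = e j + CARD('n) div 2 then - 1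
     else 0)"

definition Sp :: "('n \<Rightarrow> nat) \<Rightarrow> (real^'n^'n) set" where
  "Sp e = {M. transpose M ** symplectic_form e ** M = symplectic_form e}"

definition admissible_group :: "(real^'n^'n) set \<Rightarrow> bool" where
  "admissible_group G \<longleftrightarrow>
     G = GL \<or> G = SL \<or>
     (even CARD('n) \<and> (\<exists>e. bij_betw e (UNIV :: 'n set) {..<CARD('n)} \<and> G = Sp e))"

section \<open>Spectral subspaces of a real matrix\<close>

definition complex_vec :: "real^'n \<Rightarrow> complex^'n" where
  "complex_vec x = (\<chi> i. of_real (x $ i))"

definition eigenvalue :: "real^'n^'n \<Rightarrow> complex \<Rightarrow> bool" where
  "eigenvalue M \<mu> \<longleftrightarrow> (\<exists>v. v \<noteq> 0 \<and> map_matrix of_real M *v v = \<mu> *s v)"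

definition generalized_eigenspace :: "real^'n^'n \<Rightarrow> complex \<Rightarrow> (complex^'n) set" where
  "generalized_eigenspace M \<mu> =
     {v. \<exists>k. ((\<lambda>w. map_matrix of_real M *v w - \<mu> *s w) ^^ k) v = 0}"

text \<open>Eigenvalues may be non-real: the sum of the generalized eigenspaces is formed over the
  complex numbers, and its real vectors are then taken.\<close>

definition spectral_subspace :: "real^'n^'n \<Rightarrow> complex set \<Rightarrow> (real^'n) set" where
  "spectral_subspace M S =
     {x. complex_vec x \<in>
        vec.span (\<Union>\<mu>\<in>{\<mu>. eigenvalue M \<mu> \<and> \<mu> \<in> S}. generalized_eigenspace M \<mu>)}"

section \<open>Periodic cocycles\<close>

definition periodic_cocycle :: "(real^'n^'n) set \<Rightarrow> nat \<Rightarrow> (int \<Rightarrow> real^'n^'n) \<Rightarrow> bool" where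
  "periodic_cocycle G l A \<longleftrightarrow> l \<ge> 1 \<and> (\<forall>i. A i \<in> G) \<and> (\<forall>i. A (i + int l) = A i)"

text \<open>\<open>cocycle_prod A i n\<close> is the product \<open>A (i + n - 1) ** \<dots> ** A i\<close>.\<close>

primrec cocycle_prod :: "(int \<Rightarrow> real^'n^'n) \<Rightarrow> int \<Rightarrow> nat \<Rightarrow> real^'n^'n" where
  "cocycle_prod A i 0 = mat 1"
| "cocycle_prod A i (Suc n) = A (i + int n) ** cocycle_prod A i n"

definition hyperbolic :: "nat \<Rightarrow> (int \<Rightarrow> real^'n^'n) \<Rightarrow> bool" where
  "hyperbolic l A \<longleftrightarrow> \<not> (\<exists>\<mu>. eigenvalue (cocycle_prod A 1 l) \<mu> \<and> cmod \<mu> = 1)"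

definition bounded_by :: "real \<Rightarrow> (int \<Rightarrow> real^'n^'n) \<Rightarrow> bool" where
  "bounded_by C A \<longleftrightarrow> (\<forall>i. max (op_norm (A i)) (op_norm (matrix_inv (A i))) \<le> C)"

definition stable_space :: "nat \<Rightarrow> (int \<Rightarrow> real^'n^'n) \<Rightarrow> int \<Rightarrow> (real^'n) set" where
  "stable_space l A i = spectral_subspace (cocycle_prod A i l) {\<mu>. cmod \<mu> < 1}"

definition unstable_space :: "nat \<Rightarrow> (int \<Rightarrow> real^'n^'n) \<Rightarrow> int \<Rightarrow> (real^'n) set" where
  "unstable_space l A i = spectral_subspace (cocycle_prod A i l) {\<mu>. cmod \<mu> > 1}"

definition invariant_splitting ::
  "(int \<Rightarrow> real^'n^'n) \<Rightarrow> (int \<Rightarrow> (real^'n) set) \<Rightarrow> (int \<Rightarrow> (real^'n) set) \<Rightarrow> bool" where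
  "invariant_splitting A E F \<longleftrightarrow>
     (\<forall>i. subspace (E i) \<and> subspace (F i) \<and>
          E i \<inter> F i = {0} \<and> (\<forall>x. \<exists>u\<in>E i. \<exists>v\<in>F i. x = u + v) \<and>
          E i \<noteq> {0} \<and> F i \<noteq> {0} \<and>
          (\<lambda>x. A i *v x) ` E i = E (i + 1) \<and> (\<lambda>x. A i *v x) ` F i = F (i + 1))"

definition dominated_splitting ::
  "nat \<Rightarrow> (int \<Rightarrow> real^'n^'n) \<Rightarrow> (int \<Rightarrow> (real^'n) set) \<Rightarrow> (int \<Rightarrow> (real^'n) set) \<Rightarrow> bool" where
  "dominated_splitting N A E F \<longleftrightarrow>
     invariant_splitting A E F \<and>
     (\<forall>i. \<forall>n\<ge>N. \<forall>u\<in>E i. \<forall>v\<in>F i. norm u = 1 \<longrightarrow> norm v = 1 \<longrightarrow>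
        norm (cocycle_prod A i n *v u) \<le> 1 / 2 * norm (cocycle_prod A i n *v v))"

section \<open>Angles\<close>

definition vector_angle :: "real^'n \<Rightarrow> real^'n \<Rightarrow> real" where
  "vector_angle u v = arccos ((u \<bullet> v) / (norm u * norm v))"

text \<open>Meaningful only if both subspaces are nontrivial.\<close>

definition subspace_angle :: "(real^'n) set \<Rightarrow> (real^'n) set \<Rightarrow> real" where
  "subspace_angle E F = Inf {vector_angle u v | u v. u \<in> E - {0} \<and> v \<in> F - {0}}"

section \<open>Paths of perturbations\<close>

definition perturbation_path ::
  "(real^'n^'n) set \<Rightarrow> real \<Rightarrow> nat \<Rightarrow> (int \<Rightarrow> real^'n^'n) \<Rightarrow> (real \<Rightarrow> int \<Rightarrow> real^'n^'n) \<Rightarrow> bool" where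
  "perturbation_path G \<epsilon> l A B \<longleftrightarrow>
     (\<forall>t\<in>{0..1}. periodic_cocycle G l (B t)) \<and>
     (\<forall>i. continuous_on {0..1} (\<lambda>t. B t i)) \<and>
     B 0 = A \<and>
     (\<forall>t\<in>{0..1}. \<forall>i.
        max (op_norm (A i - B t i)) (op_norm (matrix_inv (A i) - matrix_inv (B t i))) < \<epsilon>)"

end

theory Submission
  imports Defs "HOL-Computational_Algebra.Fundamental_Theorem_Algebra"
begin

text \<open>
  If some angle is already small, a constant path will do. Otherwise the perturbation is sought as a
  conjugation of the cocycle. Let \<open>L\<^sub>i\<close> be a periodic family of matrices that kill \<open>E\<^sup>s\<^sub>i\<close> and
  take values in it. The products \<open>L\<^sub>i L\<^sub>i\<close> and \<open>L\<^sub>i\<^sub>+\<^sub>1 A\<^sub>i L\<^sub>i\<close> vanish, so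

    \<open>(1 + t L\<^sub>i\<^sub>+\<^sub>1) A\<^sub>i (1 - t L\<^sub>i) = A\<^sub>i + t (L\<^sub>i\<^sub>+\<^sub>1 A\<^sub>i - A\<^sub>i L\<^sub>i)\<close>.

  The path on the left keeps the eigenvalues, hence hyperbolicity, and it is small when \<open>L\<close> is almost
  equivariant. Its unstable space at \<open>t = 1\<close> is the graph of \<open>L\<close> over \<open>E\<^sup>u\<close>, which makes a small angle
  with the unchanged stable space wherever \<open>L\<close> is large. It remains to find an almost equivariant,
  somewhere large, periodic family, called a quasi-mode below
  (\<open>reaches_small_angle_if_quasi_mode\<close>).

  Quasi-modes are built from orbits \<open>\<Lambda>\<^sub>k = A\<^sup>k \<Lambda>\<^sub>0 A\<^sup>-\<^sup>k\<close>, where \<open>A\<^sup>k\<close> denotes the product of \<open>k\<close>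
  consecutive factors. An orbit is multiplied by slowly varying weights and then summed over each
  residue class modulo the period. Such an orbit tends to zero in the future. There are two cases, with
  a threshold \<open>K\<close> that depends only on \<open>C\<close> and \<open>\<epsilon>\<close>.

  If some orbit grows by more than the factor \<open>K\<close> before it decays, weight it with \<open>cos (\<theta> k)\<close> and
  \<open>sin (\<theta> k)\<close> for \<open>\<theta> \<le> 2 \<pi> / l\<close>. The only danger is that contributions of different periods cancel,
  and Fourier inversion in the number of the period shows that they cannot do so for every \<open>\<theta>\<close>. As
  \<open>l\<close> is large, \<open>\<theta>\<close> is small, so the weights vary slowly
  (\<open>quasi_mode_from_transient_growth\<close>).

  If no orbit grows by more than \<open>K\<close>, then failure of domination provides an orbit that at some time
  \<open>n \<ge> N\<close> still has a fixed fraction of its initial size. Its size is then bounded from above and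
  below on the whole time span, and a tent-shaped weight on a window no longer than the period reaches a
  height proportional to the length of the window (\<open>quasi_mode_from_moderate_orbit\<close>).

  The group enters only through the matrices that are allowed as \<open>L\<close>. Since \<open>1 + L\<close> is unipotent, any
  \<open>L\<close> is allowed for \<open>GL\<close> and \<open>SL\<close>. For \<open>Sp\<close> the matrix \<open>L\<close> has to lie in the Lie algebra, and the
  orbits are those of infinitesimal transvections along stable vectors
  (\<open>surviving_transvection\<close>).

  The linear algebra behind all this is the decomposition into generalized eigenspaces, which is
  obtained over the complex numbers from annihilating polynomials and then carried to real vectors.
\<close>

section \<open>Generalized eigenspaces span\<close>

lemma map_matrix_of_real_mult:
  "map_matrix complex_of_real (A ** B) = map_matrix of_real A ** map_matrix of_real B"
  for A B :: "real^'n^'n"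
  by (simp add: vec_eq_iff matrix_matrix_mult_def)

lemma map_matrix_of_real_mult_complex_vec:
  "map_matrix complex_of_real M *v complex_vec x = complex_vec (M *v x)"
  for M :: "real^'n^'n"
  by (simp add: vec_eq_iff matrix_vector_mult_def complex_vec_def)

lemma norm_complex_vec [simp]: "norm (complex_vec x) = norm x"
  by (simp add: norm_vec_def complex_vec_def)

lemma complex_vec_linear:
  "complex_vec 0 = 0"
  "complex_vec (x + y) = complex_vec x + complex_vec y"
  "complex_vec (r *\<^sub>R x) = of_real r *s complex_vec x"
  by (simp_all add: vec_eq_iff complex_vec_def)

abbreviation shift :: "complex^'n^'n \<Rightarrow> complex \<Rightarrow> complex^'n \<Rightarrow> complex^'n" where
  "shift W \<mu> \<equiv> \<lambda>w. W *v w - \<mu> *s w"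

lemma shift_linear:
  "shift W \<mu> 0 = 0"
  "shift W \<mu> (a + b) = shift W \<mu> a + shift W \<mu> b"
  "shift W \<mu> (a - b) = shift W \<mu> a - shift W \<mu> b"
  "shift W \<mu> (c *s a) = c *s shift W \<mu> a"
  by (simp_all add: vec_eq_iff matrix_vector_mult_def algebra_simps sum.distrib sum_distrib_left
      sum_subtractf)

lemma funpow_shift_linear:
  "(shift W \<mu> ^^ k) 0 = 0"
  "(shift W \<mu> ^^ k) (a + b) = (shift W \<mu> ^^ k) a + (shift W \<mu> ^^ k) b"
  "(shift W \<mu> ^^ k) (c *s a) = c *s (shift W \<mu> ^^ k) a"
  by (induction k) (simp_all only: funpow.simps id_apply o_apply shift_linear)

lemma funpow_matrix_linear:
  fixes W :: "'a::field^'n^'n"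
  shows "((*v) W ^^ k) 0 = 0"
    and "((*v) W ^^ k) (a + b) = ((*v) W ^^ k) a + ((*v) W ^^ k) b"
    and "((*v) W ^^ k) (c *s a) = c *s ((*v) W ^^ k) a"
  by (induction k)
    (simp_all add: matrix_vector_right_distrib vec.scale)

lemma generalized_eigenspaceI:
  "(shift (map_matrix of_real M) \<mu> ^^ k) v = 0 \<Longrightarrow> v \<in> generalized_eigenspace M \<mu>"
  by (auto simp: generalized_eigenspace_def)

lemma eigenvalue_if_generalized_eigenvector:
  assumes "v \<in> generalized_eigenspace M \<mu>" "v \<noteq> 0"
  shows "eigenvalue M \<mu>"
proof -
  let ?f = "shift (map_matrix of_real M) \<mu>"
  obtain k where "(?f ^^ k) v = 0"
    using assms(1) by (auto simp: generalized_eigenspace_def)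
  then show ?thesis using assms(2)
  proof (induction k arbitrary: v)
    case 0
    then show ?case by simp
  next
    case (Suc k)
    show ?case
    proof (cases "?f v = 0")
      case True
      then show ?thesis using Suc.prems(2) unfolding eigenvalue_def by auto
    next
      case False
      have "(?f ^^ k) (?f v) = 0"
        using Suc.prems(1) by (simp only: funpow_Suc_right o_apply)
      then show ?thesis using Suc.IH False by blast
    qed
  qed
qed

text \<open>On the generalized eigenspace for \<open>\<nu>\<close>, the operator \<open>W - \<mu> = (\<nu> - \<mu>) + (W - \<nu>)\<close> is a
  nonzero scalar plus a nilpotent operator, hence onto.\<close>

lemma shift_onto_other_generalized_eigenspace:
  assumes "(shift W \<nu> ^^ k) y = 0" "\<mu> \<noteq> \<nu>"
  shows "\<exists>z. (shift W \<nu> ^^ k) z = 0 \<and> shift W \<mu> z = y"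
  using assms(1)
proof (induction k arbitrary: y)
  case 0
  then show ?case by (intro exI[of _ 0]) simp
next
  case (Suc k)
  define a where "a = 1 / (\<nu> - \<mu>)"
  have a: "a * (\<nu> - \<mu>) = 1" using assms(2) by (simp add: a_def)
  have eq: "y - shift W \<mu> (a *s y) = (- a) *s shift W \<nu> y"
  proof -
    have "shift W \<mu> (a *s y) = a *s shift W \<nu> y + (a * (\<nu> - \<mu>)) *s y"
      by (simp add: vec_eq_iff vec.scale algebra_simps)
    then show ?thesis by (simp add: a)
  qed
  have "(shift W \<nu> ^^ k) (y - shift W \<mu> (a *s y)) = 0"
    unfolding eq funpow_shift_linear
    using Suc.prems by (simp only: funpow_Suc_right o_apply) simp
  then obtain z where z: "(shift W \<nu> ^^ k) z = 0" "shift W \<mu> z = y - shift W \<mu> (a *s y)"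
    using Suc.IH by blast
  have "(shift W \<nu> ^^ Suc k) z = 0"
    using z(1) by (simp only: funpow.simps o_apply shift_linear)
  then have "(shift W \<nu> ^^ Suc k) (a *s y + z) = 0"
    using Suc.prems by (simp only: funpow_shift_linear) simp
  moreover have "shift W \<mu> (a *s y + z) = y"
    using z(2) by (simp only: shift_linear) simp
  ultimately show ?case by blast
qed

definition spectral_span :: "real^'n^'n \<Rightarrow> complex set \<Rightarrow> (complex^'n) set" where
  "spectral_span M S =
     vec.span (\<Union>\<mu>\<in>{\<mu>. eigenvalue M \<mu> \<and> \<mu> \<in> S}. generalized_eigenspace M \<mu>)"

lemma spectral_subspace_iff: "x \<in> spectral_subspace M S \<longleftrightarrow> complex_vec x \<in> spectral_span M S"
  by (simp add: spectral_subspace_def spectral_span_def)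

lemma generalized_eigenspace_subset_spectral_span:
  "v \<in> generalized_eigenspace M \<mu> \<Longrightarrow> \<mu> \<in> S \<Longrightarrow> v \<in> spectral_span M S"
  unfolding spectral_span_def
  by (cases "v = 0") (auto simp: vec.span_zero intro!: vec.span_base
      dest: eigenvalue_if_generalized_eigenvector)

lemma spectral_span_closed:
  "0 \<in> spectral_span M S"
  "a \<in> spectral_span M S \<Longrightarrow> b \<in> spectral_span M S \<Longrightarrow> a + b \<in> spectral_span M S"
  "a \<in> spectral_span M S \<Longrightarrow> c *s a \<in> spectral_span M S"
  unfolding spectral_span_def by (auto intro: vec.span_zero vec.span_add vec.span_scale)

lemma spectral_span_induct [consumes 1, case_names zero add scale base]:
  assumes "v \<in> spectral_span M S"
    and "P 0" and "\<And>a b. P a \<Longrightarrow> P b \<Longrightarrow> P (a + b)" and "\<And>c a. P a \<Longrightarrow> P (c *s a)"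
    and "\<And>\<mu> v k. eigenvalue M \<mu> \<Longrightarrow> \<mu> \<in> S \<Longrightarrow> (shift (map_matrix of_real M) \<mu> ^^ k) v = 0 \<Longrightarrow> P v"
  shows "P v"
  using assms(1) unfolding spectral_span_def
proof (rule vec.span_induct)
  show "vec.subspace (Collect P)"
    using assms(2-4) by (auto simp: vec.subspace_def)
next
  fix x assume "x \<in> (\<Union>\<mu>\<in>{\<mu>. eigenvalue M \<mu> \<and> \<mu> \<in> S}. generalized_eigenspace M \<mu>)"
  then show "P x" using assms(5) by (auto simp: generalized_eigenspace_def)
qed

text \<open>Let \<open>f = M - \<mu>\<close>. As \<open>f\<close> is onto on every generalized eigenspace other than its own,
  each element of the span differs from some \<open>f z\<close>, with \<open>z\<close> in the span, by a vector that a power of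
  \<open>f\<close> kills. Applied to \<open>f v\<close>, this makes \<open>v - z\<close> a generalized eigenvector.\<close>

lemma spectral_span_pull_back:
  assumes "shift (map_matrix of_real M) \<mu> v \<in> spectral_span M UNIV"
  shows "v \<in> spectral_span M UNIV"
proof -
  let ?f = "shift (map_matrix of_real M) \<mu>"
  have "\<exists>z\<in>spectral_span M UNIV. \<exists>k. (?f ^^ k) (y - ?f z) = 0"
    if "y \<in> spectral_span M UNIV" for y
    using that
  proof (induction rule: spectral_span_induct)
    case zero
    show ?case by (intro bexI[of _ 0] exI[of _ 0]) (simp_all add: spectral_span_closed)
  next
    case (add a b)
    then obtain z k z' k' where z: "z \<in> spectral_span M UNIV" "(?f ^^ k) (a - ?f z) = 0"
      "z' \<in> spectral_span M UNIV" "(?f ^^ k') (b - ?f z') = 0" by blast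
    have eq: "a + b - ?f (z + z') = (a - ?f z) + (b - ?f z')"
      by (simp only: shift_linear) simp
    have "(?f ^^ (k + k')) (a + b - ?f (z + z')) = 0"
    proof -
      have "(?f ^^ (k' + k)) (a - ?f z) = 0" "(?f ^^ (k + k')) (b - ?f z') = 0"
        by (simp_all only: funpow_add o_apply z funpow_shift_linear)
      then show ?thesis by (simp only: eq funpow_shift_linear(2) add.commute[of k']) simp
    qed
    then show ?case using z spectral_span_closed(2) by blast
  next
    case (scale c a)
    then obtain z k where z: "z \<in> spectral_span M UNIV" "(?f ^^ k) (a - ?f z) = 0" by blast
    have eq: "c *s a - ?f (c *s z) = c *s (a - ?f z)"
      by (simp only: shift_linear) (simp add: vec.scale_right_diff_distrib)
    have "(?f ^^ k) (c *s a - ?f (c *s z)) = 0"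
      by (simp only: eq funpow_shift_linear(3) z) simp
    then show ?case using z spectral_span_closed(3) by blast
  next
    case (base \<nu> v k)
    show ?case
    proof (cases "\<nu> = \<mu>")
      case True
      then show ?thesis using base
        by (intro bexI[of _ 0] exI[of _ k]) (simp_all add: spectral_span_closed)
    next
      case False
      then obtain z where "(shift (map_matrix of_real M) \<nu> ^^ k) z = 0" "?f z = v"
        using shift_onto_other_generalized_eigenspace[OF base(3), of \<mu>] by blast
      then show ?thesis
        by (intro bexI[of _ z] exI[of _ 0])
          (auto intro: generalized_eigenspace_subset_spectral_span generalized_eigenspaceI)
    qed
  qed
  then obtain z k where z: "z \<in> spectral_span M UNIV" "(?f ^^ k) (?f v - ?f z) = 0"
    using assms by blast
  have "(?f ^^ Suc k) (v - z) = 0"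
    using z(2) by (simp only: funpow_Suc_right o_apply shift_linear)
  then have "v - z \<in> spectral_span M UNIV"
    by (blast intro: generalized_eigenspace_subset_spectral_span generalized_eigenspaceI)
  then show ?thesis using spectral_span_closed(2)[OF _ z(1)] by fastforce
qed

text \<open>Split off the roots of the annihilating polynomial one by one.\<close>

lemma in_spectral_span_if_annihilated:
  fixes p :: "complex poly"
  assumes "p \<noteq> 0" "degree p < m"
    and "(\<Sum>i<m. coeff p i *s ((*v) (map_matrix of_real M) ^^ i) v) = 0"
  shows "v \<in> spectral_span M UNIV"
  using assms
proof (induction "degree p" arbitrary: p v m)
  case 0
  then obtain c where c: "p = [:c:]" "c \<noteq> 0" by (metis degree_eq_zeroE pCons_0_0)
  have "(\<Sum>i<m. coeff p i *s ((*v) (map_matrix of_real M) ^^ i) v) = (\<Sum>i<m. if i = 0 then c *s v else 0)"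
    by (intro sum.cong) (auto simp: c coeff_pCons split: nat.split)
  also have "\<dots> = c *s v" using 0 by (simp add: sum.delta)
  finally show ?case using 0 c by (simp add: spectral_span_closed)
next
  case (Suc d)
  let ?W = "map_matrix of_real M :: complex^'a^'a"
  have "\<not> constant (poly p)" using Suc.hyps(2) by (simp add: constant_degree)
  then obtain \<mu> where "poly p \<mu> = 0" using fundamental_theorem_of_algebra by blast
  then obtain q where q: "p = [:-\<mu>, 1:] * q" by (metis dvdE poly_eq_0_iff_dvd)
  have q0: "q \<noteq> 0" using Suc.prems(1) q by auto
  have dq: "degree p = Suc (degree q)"
    using q0 by (simp only: q) (subst degree_mult_eq, auto)
  obtain m' where m': "m = Suc m'" using Suc.prems(2) by (cases m) auto
  have cm: "coeff q m' = 0" using dq Suc.prems(2) m' by (intro coeff_eq_0) simp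
  have "(\<Sum>i<m. coeff p i *s ((*v) ?W ^^ i) v)
      = (\<Sum>i<Suc m'. (coeff (pCons 0 q) i - \<mu> * coeff q i) *s ((*v) ?W ^^ i) v)"
    unfolding m' q by (intro sum.cong) simp_all
  also have "\<dots> = (\<Sum>i<Suc m'. coeff (pCons 0 q) i *s ((*v) ?W ^^ i) v)
                - (\<Sum>i<Suc m'. (\<mu> * coeff q i) *s ((*v) ?W ^^ i) v)"
    by (simp only: vec.scale_left_diff_distrib sum_subtractf)
  also have "(\<Sum>i<Suc m'. coeff (pCons 0 q) i *s ((*v) ?W ^^ i) v)
     = (\<Sum>i<m'. coeff q i *s ((*v) ?W ^^ i) (?W *v v))"
    by (simp add: sum.lessThan_Suc_shift funpow_swap1 del: sum.lessThan_Suc)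
  also have "(\<Sum>i<Suc m'. (\<mu> * coeff q i) *s ((*v) ?W ^^ i) v)
     = (\<Sum>i<m'. (\<mu> * coeff q i) *s ((*v) ?W ^^ i) v)"
    using cm by simp
  also have "(\<Sum>i<m'. coeff q i *s ((*v) ?W ^^ i) (?W *v v)) - (\<Sum>i<m'. (\<mu> * coeff q i) *s ((*v) ?W ^^ i) v)
     = (\<Sum>i<m'. coeff q i *s ((*v) ?W ^^ i) (shift ?W \<mu> v))"
  proof -
    have "((*v) ?W ^^ i) (shift ?W \<mu> v) = ((*v) ?W ^^ i) (?W *v v) - \<mu> *s ((*v) ?W ^^ i) v" for i
      using funpow_matrix_linear(2)[of i ?W "shift ?W \<mu> v" "\<mu> *s v"]
        funpow_matrix_linear(3)[of i ?W \<mu> v] by simp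
    then show ?thesis
      by (simp add: sum_subtractf[symmetric] vec.scale_right_diff_distrib mult.commute)
  qed
  finally have "(\<Sum>i<m'. coeff q i *s ((*v) ?W ^^ i) (shift ?W \<mu> v)) = 0"
    using Suc.prems(3) by simp
  moreover have "degree q < m'" "d = degree q" using dq Suc.prems(2) Suc.hyps(2) m' by auto
  ultimately have "shift ?W \<mu> v \<in> spectral_span M UNIV"
    using Suc.hyps(1)[of q] q0 by blast
  then show ?case by (rule spectral_span_pull_back)
qed

lemma exists_annihilating_combination:
  fixes f :: "nat \<Rightarrow> complex^'n"
  shows "\<exists>c. (\<exists>i\<le>CARD('n). c i \<noteq> 0) \<and> (\<Sum>i\<le>CARD('n). c i *s f i) = 0"
proof (cases "inj_on f {..CARD('n)}")
  case False
  then obtain i j where ij: "i \<le> CARD('n)" "j \<le> CARD('n)" "i \<noteq> j" "f i = f j"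
    by (auto simp: inj_on_def)
  let ?c = "\<lambda>k. (if k = i then 1 else 0) - (if k = j then 1 else 0) :: complex"
  have "(\<Sum>k\<le>CARD('n). ?c k *s f k) = (\<Sum>k\<le>CARD('n). (if k = i then f k else 0) - (if k = j then f k else 0))"
    by (intro sum.cong) auto
  also have "\<dots> = 0"
    using ij by (simp add: sum_subtractf sum.delta)
  finally show ?thesis using ij by (intro exI[of _ ?c]) auto
next
  case True
  have "vec.dependent (f ` {..CARD('n)})"
  proof (rule ccontr)
    assume "\<not> ?thesis"
    then have "card (f ` {..CARD('n)}) \<le> vec.dim (f ` {..CARD('n)})"
      using vec.dim_eq_card_independent[of "f ` {..CARD('n)}"] by simp
    also have "\<dots> \<le> CARD('n)" using vec.dim_subset_UNIV[of "f ` {..CARD('n)}"]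
      by (simp add: vec.dimension_def card_cart_basis vec.dim_UNIV)
    finally show False using True by (simp add: card_image)
  qed
  then obtain u where u: "\<exists>v\<in>f ` {..CARD('n)}. u v \<noteq> 0" "(\<Sum>v\<in>f ` {..CARD('n)}. u v *s v) = 0"
    using vec.dependent_finite[of "f ` {..CARD('n)}"] by auto
  have "(\<Sum>i\<le>CARD('n). u (f i) *s f i) = 0"
    using u(2) by (simp add: sum.reindex[OF True] o_def)
  then show ?thesis using u(1) by (intro exI[of _ "\<lambda>i. u (f i)"]) auto
qed

lemma spectral_span_UNIV: "v \<in> spectral_span M UNIV"
proof -
  let ?n = "CARD('a)"
  obtain c where c: "\<exists>i\<le>?n. c i \<noteq> 0"
    "(\<Sum>i\<le>?n. c i *s ((*v) (map_matrix of_real M) ^^ i) v) = 0"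
    using exists_annihilating_combination[of "\<lambda>i. ((*v) (map_matrix of_real M) ^^ i) v"] by blast
  define p where "p = (\<Sum>i\<le>?n. monom (c i) i)"
  have cp: "coeff p i = c i" if "i \<le> ?n" for i
    using that by (simp add: p_def coeff_sum sum.delta)
  have "degree p \<le> ?n" unfolding p_def
    by (intro degree_sum_le) (auto intro: order_trans[OF degree_monom_le])
  moreover have "p \<noteq> 0" using c(1) cp by (metis coeff_0)
  moreover have "(\<Sum>i<Suc ?n. coeff p i *s ((*v) (map_matrix of_real M) ^^ i) v) = 0"
    using c(2) cp by (simp add: lessThan_Suc_atMost)
  ultimately show ?thesis by (intro in_spectral_span_if_annihilated[of p "Suc ?n"]) auto
qed

section \<open>The spectral splitting of a real matrix\<close>

definition cnj_vec :: "complex^'n \<Rightarrow> complex^'n" where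
  "cnj_vec v = (\<chi> i. cnj (v $ i))"

lemma cnj_vec_shift:
  "cnj_vec (shift (map_matrix of_real M) \<mu> v) = shift (map_matrix of_real M) (cnj \<mu>) (cnj_vec v)"
  by (simp add: vec_eq_iff cnj_vec_def matrix_vector_mult_def cnj_sum)

lemma cnj_vec_simps:
  "cnj_vec 0 = 0" "cnj_vec (a + b) = cnj_vec a + cnj_vec b" "cnj_vec (c *s a) = cnj c *s cnj_vec a"
  "cnj_vec v = 0 \<longleftrightarrow> v = 0" "cnj_vec (complex_vec x) = complex_vec x"
  by (simp_all add: vec_eq_iff cnj_vec_def complex_vec_def)

lemma cnj_vec_spectral_span:
  assumes "\<And>\<mu>. \<mu> \<in> S \<Longrightarrow> cnj \<mu> \<in> S" and "v \<in> spectral_span M S"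
  shows "cnj_vec v \<in> spectral_span M S"
  using assms(2)
proof (induction rule: spectral_span_induct)
  case (base \<mu> v k)
  have "(shift (map_matrix of_real M) (cnj \<mu>) ^^ k) (cnj_vec v)
      = cnj_vec ((shift (map_matrix of_real M) \<mu> ^^ k) v)"
    by (induction k) (simp_all only: funpow.simps id_apply o_apply cnj_vec_shift)
  then show ?case
    using base assms(1)
    by (auto simp: cnj_vec_simps intro!: generalized_eigenspace_subset_spectral_span
        generalized_eigenspaceI[where k = k])
qed (simp_all add: cnj_vec_simps spectral_span_closed)

lemma subspace_spectral_subspace: "subspace (spectral_subspace M S)"
  by (auto simp: subspace_def spectral_subspace_iff complex_vec_linear spectral_span_closed)

text \<open>Real parts of a complex decomposition decompose a real vector, because the two pieces are
  stable under complex conjugation.\<close>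

lemma real_vector_decomposition:
  assumes no_unit: "\<And>\<mu>. eigenvalue M \<mu> \<Longrightarrow> cmod \<mu> \<noteq> 1"
  shows "\<exists>u\<in>spectral_subspace M {\<mu>. cmod \<mu> < 1}. \<exists>v\<in>spectral_subspace M {\<mu>. cmod \<mu> > 1}. x = u + v"
proof -
  let ?S = "{\<mu>. cmod \<mu> < 1}" and ?U = "{\<mu>. cmod \<mu> > 1}"
  have "\<exists>a\<in>spectral_span M ?S. \<exists>b\<in>spectral_span M ?U. v = a + b" for v
    using spectral_span_UNIV[of v M]
  proof (induction rule: spectral_span_induct)
    case zero
    show ?case by (intro bexI[of _ 0]) (simp_all add: spectral_span_closed)
  next
    case (add a b)
    then obtain a1 a2 b1 b2 where
      "a1 \<in> spectral_span M ?S" "a2 \<in> spectral_span M ?U" "a = a1 + a2"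
      "b1 \<in> spectral_span M ?S" "b2 \<in> spectral_span M ?U" "b = b1 + b2" by blast
    then show ?case
      by (intro bexI[of _ "a1 + b1"] bexI[of _ "a2 + b2"]) (simp_all add: spectral_span_closed)
  next
    case (scale c a)
    then obtain a1 a2 where
      "a1 \<in> spectral_span M ?S" "a2 \<in> spectral_span M ?U" "a = a1 + a2" by blast
    then show ?case
      by (intro bexI[of _ "c *s a1"] bexI[of _ "c *s a2"])
        (simp_all add: spectral_span_closed vec.scale_right_distrib)
  next
    case (base \<mu> v k)
    then have v: "v \<in> generalized_eigenspace M \<mu>" by (blast intro: generalized_eigenspaceI)
    consider "\<mu> \<in> ?S" | "\<mu> \<in> ?U" using no_unit[OF base(1)] by fastforce
    then show ?case
    proof cases
      case 1
      show ?thesis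
        by (intro bexI[of _ v] bexI[of _ 0])
          (simp_all add: spectral_span_closed generalized_eigenspace_subset_spectral_span[OF v 1])
    next
      case 2
      show ?thesis
        by (intro bexI[of _ 0] bexI[of _ v])
          (simp_all add: spectral_span_closed generalized_eigenspace_subset_spectral_span[OF v 2])
    qed
  qed
  then obtain a b where ab: "a \<in> spectral_span M ?S" "b \<in> spectral_span M ?U"
    "complex_vec x = a + b" by blast
  define re where "re v = (\<chi> i. Re (v $ i))" for v :: "complex^'a"
  have re: "complex_vec (re v) = (1/2) *s (v + cnj_vec v)" for v :: "complex^'a"
    by (simp add: vec_eq_iff complex_vec_def re_def cnj_vec_def complex_eq_iff)
  have "re a \<in> spectral_subspace M ?S" "re b \<in> spectral_subspace M ?U"
    unfolding spectral_subspace_iff re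
    using ab by (auto intro!: spectral_span_closed cnj_vec_spectral_span)
  moreover have "x = re a + re b"
    using ab(3) by (simp add: vec_eq_iff re_def complex_vec_def complex_eq_iff)
  ultimately show ?thesis by blast
qed

lemma norm_vector_scale: "norm (c *s v) = cmod c * norm v" for v :: "complex^'n"
  by (simp add: norm_vec_def norm_mult L2_set_right_distrib)

text \<open>A Jordan chain only costs a polynomial factor; enlarging the rate \<open>\<rho>\<close> at every step of the
  chain absorbs it.\<close>

lemma generalized_eigenvector_decay:
  fixes W :: "complex^'n^'n"
  assumes "cmod \<mu> < 1" "(shift W \<mu> ^^ k) v = 0"
  shows "\<exists>c \<rho>. 0 \<le> \<rho> \<and> \<rho> < 1 \<and> (\<forall>q. norm (((*v) W ^^ q) v) \<le> c * \<rho> ^ q)"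
  using assms(2)
proof (induction k arbitrary: v)
  case 0
  then show ?case by (intro exI[of _ 0]) (simp add: funpow_matrix_linear)
next
  case (Suc k)
  let ?y = "shift W \<mu> v"
  have "(shift W \<mu> ^^ k) ?y = 0" using Suc.prems by (simp only: funpow_Suc_right o_apply)
  then obtain c \<rho> where c: "0 \<le> \<rho>" "\<rho> < 1" "\<And>q. norm (((*v) W ^^ q) ?y) \<le> c * \<rho> ^ q"
    using Suc.IH by blast
  define \<sigma> where "\<sigma> = (1 + max \<rho> (cmod \<mu>)) / 2"
  have \<sigma>: "\<rho> \<le> \<sigma>" "cmod \<mu> < \<sigma>" "\<sigma> < 1" "0 \<le> \<sigma>" using c(1,2) assms(1) by (auto simp: \<sigma>_def)
  define d where "d = max (norm v) (c / (\<sigma> - cmod \<mu>))"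
  have c0: "0 \<le> c" using order_trans[OF norm_ge_zero c(3)[of 0]] by simp
  have d: "c \<le> d * (\<sigma> - cmod \<mu>)"
  proof -
    have "c / (\<sigma> - cmod \<mu>) \<le> d" by (simp add: d_def)
    then show ?thesis using \<sigma>(2) by (simp add: pos_divide_le_eq)
  qed
  have "norm (((*v) W ^^ q) v) \<le> d * \<sigma> ^ q" for q
  proof (induction q)
    case 0
    show ?case by (simp add: d_def)
  next
    case (Suc q)
    have "((*v) W ^^ Suc q) v = ((*v) W ^^ q) (?y + \<mu> *s v)"
      by (simp only: funpow_Suc_right o_apply diff_add_cancel)
    then have "((*v) W ^^ Suc q) v = ((*v) W ^^ q) ?y + \<mu> *s ((*v) W ^^ q) v"
      by (simp only: funpow_matrix_linear)
    then have "norm (((*v) W ^^ Suc q) v)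
        \<le> norm (((*v) W ^^ q) ?y) + cmod \<mu> * norm (((*v) W ^^ q) v)"
      using norm_triangle_ineq[of "((*v) W ^^ q) ?y" "\<mu> *s ((*v) W ^^ q) v"]
      by (simp only: norm_vector_scale)
    also have "\<dots> \<le> c * \<rho> ^ q + cmod \<mu> * (d * \<sigma> ^ q)"
      by (intro add_mono c(3) mult_left_mono Suc.IH norm_ge_zero)
    also have "c * \<rho> ^ q \<le> d * (\<sigma> - cmod \<mu>) * \<sigma> ^ q"
      using c0 d c(1) \<sigma> by (intro mult_mono power_mono) auto
    finally show ?case by (simp add: algebra_simps)
  qed
  then show ?case using \<sigma> by blast
qed

lemma spectral_span_decay:
  fixes W :: "complex^'n^'n"
  assumes "\<And>\<mu> v k. \<mu> \<in> S \<Longrightarrow> (shift (map_matrix of_real M) \<mu> ^^ k) v = 0 \<Longrightarrow>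
             \<exists>\<nu>. cmod \<nu> < 1 \<and> (shift W \<nu> ^^ k) v = 0"
    and "v \<in> spectral_span M S"
  shows "(\<lambda>q. ((*v) W ^^ q) v) \<longlonglongrightarrow> 0"
  using assms(2)
proof (induction rule: spectral_span_induct)
  case zero
  then show ?case by (simp add: funpow_matrix_linear)
next
  case (add a b)
  have "(\<lambda>q. ((*v) W ^^ q) a + ((*v) W ^^ q) b) \<longlonglongrightarrow> 0 + 0"
    by (intro tendsto_add add)
  then show ?case by (simp only: funpow_matrix_linear add_0)
next
  case (scale c a)
  have "(\<lambda>q. cmod c * norm (((*v) W ^^ q) a)) \<longlonglongrightarrow> cmod c * 0"
    by (intro tendsto_mult_left tendsto_norm_zero scale)
  then have "(\<lambda>q. norm (((*v) W ^^ q) (c *s a))) \<longlonglongrightarrow> 0"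
    by (simp only: funpow_matrix_linear norm_vector_scale mult_zero_right)
  then show ?case by (rule tendsto_norm_zero_cancel)
next
  case (base \<mu> v k)
  obtain \<nu> where "cmod \<nu> < 1" "(shift W \<nu> ^^ k) v = 0" using assms(1) base by blast
  then obtain c \<rho> where c: "0 \<le> \<rho>" "\<rho> < 1" "\<And>q. norm (((*v) W ^^ q) v) \<le> c * \<rho> ^ q"
    using generalized_eigenvector_decay by blast
  have "(\<lambda>q. c * \<rho> ^ q) \<longlonglongrightarrow> c * 0"
    using c(1,2) by (intro tendsto_mult_left LIMSEQ_realpow_zero) auto
  then have "(\<lambda>q. c * \<rho> ^ q) \<longlonglongrightarrow> 0" by (simp only: mult_zero_right)
  moreover have "eventually (\<lambda>q. norm (((*v) W ^^ q) v) \<le> c * \<rho> ^ q) sequentially"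
    by (intro always_eventually allI c(3))
  ultimately show ?case by (rule Lim_null_comparison[rotated])
qed

lemma funpow_complex_vec:
  fixes M :: "real^'n^'n"
  shows
  "((*v) (map_matrix of_real M) ^^ q) (complex_vec x) = complex_vec (((*v) M ^^ q) x)"
  by (induction q) (simp_all add: map_matrix_of_real_mult_complex_vec)

lemma complex_vec_tendsto_zero:
  "(\<lambda>q. complex_vec (f q)) \<longlonglongrightarrow> 0 \<Longrightarrow> f \<longlonglongrightarrow> 0"
  using tendsto_norm_zero[of "\<lambda>q. complex_vec (f q)"] tendsto_norm_zero_cancel[of f] by simp

lemma contracted_spectral_subspace:
  assumes "x \<in> spectral_subspace M {\<mu>. cmod \<mu> < 1}"
  shows "(\<lambda>q. ((*v) M ^^ q) x) \<longlonglongrightarrow> 0"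
proof -
  have "(\<lambda>q. ((*v) (map_matrix of_real M) ^^ q) (complex_vec x)) \<longlonglongrightarrow> 0"
  proof (rule spectral_span_decay)
    show "complex_vec x \<in> spectral_span M {\<mu>. cmod \<mu> < 1}"
      using assms by (simp only: spectral_subspace_iff)
  qed blast
  then show ?thesis
    unfolding funpow_complex_vec by (rule complex_vec_tendsto_zero)
qed

text \<open>Since \<open>M\<^sup>-\<^sup>1 - \<mu>\<^sup>-\<^sup>1 = - \<mu>\<^sup>-\<^sup>1 M\<^sup>-\<^sup>1 (M - \<mu>)\<close>, the generalized eigenspaces of \<open>M\<close> are
  those of its inverse.\<close>

lemma shift_inverse:
  fixes W V :: "complex^'n^'n"
  assumes "V ** W = mat 1" "W ** V = mat 1" "\<mu> \<noteq> 0" "(shift W \<mu> ^^ k) v = 0"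
  shows "(shift V (1 / \<mu>) ^^ k) v = 0"
  using assms(4)
proof (induction k arbitrary: v)
  case 0
  then show ?case by simp
next
  case (Suc k)
  have VW: "V *v (W *v x) = x" "W *v (V *v x) = x" for x
    using assms(1,2) by (simp_all add: matrix_vector_mul_assoc)
  have comm: "(shift W \<mu> ^^ j) (V *v x) = V *v ((shift W \<mu> ^^ j) x)" for j x
    by (induction j) (simp_all add: VW matrix_vector_mult_diff_distrib vec.scale)
  have eq: "shift V (1 / \<mu>) v = (- (1 / \<mu>)) *s (V *v shift W \<mu> v)"
    using assms(3) by (simp add: VW matrix_vector_mult_diff_distrib vec.scale vec.scale_right_diff_distrib)
  have "(shift W \<mu> ^^ k) (shift V (1 / \<mu>) v) = 0"
    unfolding eq funpow_shift_linear comm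
    using Suc.prems by (simp only: funpow_Suc_right o_apply) simp
  then show ?case using Suc.IH by (simp only: funpow_Suc_right o_apply)
qed

lemma map_matrix_of_real_one: "map_matrix of_real (mat 1 :: real^'n^'n) = (mat 1 :: complex^'n^'n)"
  by (simp add: vec_eq_iff mat_def)

lemma expanded_spectral_subspace:
  fixes M N :: "real^'n^'n"
  assumes "N ** M = mat 1" "M ** N = mat 1" and "x \<in> spectral_subspace M {\<mu>. cmod \<mu> > 1}"
  shows "(\<lambda>q. ((*v) N ^^ q) x) \<longlonglongrightarrow> 0"
proof -
  let ?M = "map_matrix of_real M :: complex^'n^'n" and ?N = "map_matrix of_real N :: complex^'n^'n"
  have inv: "?N ** ?M = mat 1" "?M ** ?N = mat 1"
    by (simp_all only: map_matrix_of_real_mult[symmetric] assms(1,2) map_matrix_of_real_one)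
  have "(\<lambda>q. ((*v) ?N ^^ q) (complex_vec x)) \<longlonglongrightarrow> 0"
  proof (rule spectral_span_decay)
    show "complex_vec x \<in> spectral_span M {\<mu>. cmod \<mu> > 1}"
      using assms(3) by (simp only: spectral_subspace_iff)
  next
    fix \<mu> v k assume \<mu>: "\<mu> \<in> {\<mu>. cmod \<mu> > 1}" and v: "(shift ?M \<mu> ^^ k) v = 0"
    have "\<mu> \<noteq> 0" using \<mu> by auto
    from shift_inverse[OF inv this v] have "(shift ?N (1 / \<mu>) ^^ k) v = 0" .
    moreover have "cmod (1 / \<mu>) < 1" using \<mu> by (simp add: norm_divide divide_less_eq)
    ultimately show "\<exists>\<nu>. cmod \<nu> < 1 \<and> (shift ?N \<nu> ^^ k) v = 0" by blast
  qed
  then show ?thesis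
    unfolding funpow_complex_vec by (rule complex_vec_tendsto_zero)
qed

lemma shift_conjugate:
  assumes "Q ** P = mat 1"
  shows "shift (P ** W ** Q) \<mu> (P *v v) = P *v shift W \<mu> v"
proof -
  have "(P ** W ** Q) *v (P *v v) = P *v (W *v ((Q ** P) *v v))"
    by (simp add: matrix_vector_mul_assoc matrix_mul_assoc)
  then show ?thesis
    by (simp add: assms matrix_vector_mult_diff_distrib vec.scale)
qed

lemma eigenvalue_conjugate:
  fixes M P Q :: "real^'n^'n"
  assumes "Q ** P = mat 1" "eigenvalue M \<mu>"
  shows "eigenvalue (P ** M ** Q) \<mu>"
proof -
  let ?P = "map_matrix of_real P :: complex^'n^'n" and ?Q = "map_matrix of_real Q :: complex^'n^'n"
  obtain v where v: "v \<noteq> 0" "map_matrix of_real M *v v = \<mu> *s v"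
    using assms(2) by (auto simp: eigenvalue_def)
  have QP: "?Q ** ?P = mat 1"
    using assms(1) by (simp add: map_matrix_of_real_mult[symmetric] map_matrix_of_real_one)
  have "shift (?P ** map_matrix of_real M ** ?Q) \<mu> (?P *v v) = 0"
    by (simp only: shift_conjugate[OF QP] v) (simp add: v)
  moreover have "?P *v v \<noteq> 0"
  proof
    assume "?P *v v = 0"
    then have "(?Q ** ?P) *v v = 0" by (simp add: matrix_vector_mul_assoc[symmetric])
    then show False using v(1) QP by simp
  qed
  ultimately show ?thesis
    unfolding eigenvalue_def by (auto simp: map_matrix_of_real_mult)
qed

lemma spectral_subspace_conjugate_subset:
  fixes M P Q :: "real^'n^'n"
  assumes "Q ** P = mat 1" "x \<in> spectral_subspace M S"
  shows "P *v x \<in> spectral_subspace (P ** M ** Q) S"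
proof -
  let ?P = "map_matrix of_real P :: complex^'n^'n" and ?Q = "map_matrix of_real Q :: complex^'n^'n"
  have QP: "?Q ** ?P = mat 1"
    using assms(1) by (simp add: map_matrix_of_real_mult[symmetric] map_matrix_of_real_one)
  have "?P *v v \<in> spectral_span (P ** M ** Q) S" if "v \<in> spectral_span M S" for v
    using that
  proof (induction rule: spectral_span_induct)
    case (base \<mu> v k)
    have "(shift (?P ** map_matrix of_real M ** ?Q) \<mu> ^^ k) (?P *v v)
        = ?P *v ((shift (map_matrix of_real M) \<mu> ^^ k) v)"
      by (induction k) (simp_all only: funpow.simps id_apply o_apply shift_conjugate[OF QP])
    then show ?case using base
      by (intro generalized_eigenspace_subset_spectral_span[where \<mu> = \<mu>]
          generalized_eigenspaceI[where k = k]) (simp_all add: map_matrix_of_real_mult)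
  qed (simp_all add: spectral_span_closed matrix_vector_right_distrib vec.scale)
  then show ?thesis
    using assms(2) by (simp add: spectral_subspace_iff map_matrix_of_real_mult_complex_vec[symmetric])
qed

lemma conjugate_back:
  fixes M P Q :: "'a::semiring_1^'n^'n"
  assumes "Q ** P = mat 1"
  shows "Q ** (P ** M ** Q) ** P = M"
proof -
  have "Q ** (P ** M ** Q) ** P = (Q ** P) ** M ** (Q ** P)"
    by (simp only: matrix_mul_assoc)
  then show ?thesis by (simp add: assms)
qed

lemma eigenvalue_conjugate_iff:
  fixes M P Q :: "real^'n^'n"
  assumes "P ** Q = mat 1" "Q ** P = mat 1"
  shows "eigenvalue (P ** M ** Q) \<mu> \<longleftrightarrow> eigenvalue M \<mu>"
  using eigenvalue_conjugate[OF assms(2), of M] eigenvalue_conjugate[OF assms(1), of "P ** M ** Q"]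
  by (auto simp: conjugate_back[OF assms(2)])

lemma spectral_subspace_conjugate:
  fixes M P Q :: "real^'n^'n"
  assumes "P ** Q = mat 1" "Q ** P = mat 1"
  shows "spectral_subspace (P ** M ** Q) S = (\<lambda>x. P *v x) ` spectral_subspace M S"
proof (intro subset_antisym subsetI)
  fix x assume "x \<in> spectral_subspace (P ** M ** Q) S"
  then have "Q *v x \<in> spectral_subspace M S"
    using spectral_subspace_conjugate_subset[OF assms(1), of x "P ** M ** Q"]
    by (simp add: conjugate_back[OF assms(2)])
  moreover have "x = P *v (Q *v x)" using assms(1) by (simp add: matrix_vector_mul_assoc)
  ultimately show "x \<in> (\<lambda>x. P *v x) ` spectral_subspace M S" by blast
qed (use spectral_subspace_conjugate_subset[OF assms(2)] in auto)

text \<open>The values on a finite orthonormal basis of \<open>V\<close> control a linear map on all of \<open>V\<close>.\<close>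

lemma uniformly_small_on_subspace:
  fixes f :: "nat \<Rightarrow> 'a::euclidean_space \<Rightarrow> 'b::real_normed_vector"
  assumes "subspace V" "\<And>q. linear (f q)" "\<And>x. x \<in> V \<Longrightarrow> (\<lambda>q. f q x) \<longlonglongrightarrow> 0" "e > 0"
  shows "eventually (\<lambda>q. \<forall>x\<in>V. norm (f q x) \<le> e * norm x) sequentially"
proof -
  obtain B where B: "B \<subseteq> V" "pairwise orthogonal B" "\<And>x. x \<in> B \<Longrightarrow> norm x = 1"
    "independent B" "span B = V"
    using orthonormal_basis_subspace[OF assms(1)] by metis
  have fin: "finite B" using B(4) by (simp add: independent_imp_finite)
  have "(\<lambda>q. \<Sum>b\<in>B. norm (f q b)) \<longlonglongrightarrow> (\<Sum>b\<in>B. 0)"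
    using B(1) assms(3) by (intro tendsto_sum tendsto_norm_zero) auto
  then have "eventually (\<lambda>q. (\<Sum>b\<in>B. norm (f q b)) < e) sequentially"
    using assms(4) by (simp add: order_tendsto_iff)
  then show ?thesis
  proof eventually_elim
    case (elim q)
    show ?case
    proof
      fix x assume "x \<in> V"
      then have x: "(\<Sum>b\<in>B. (x \<bullet> b) *\<^sub>R b) = x"
        using B fin by (intro orthonormal_basis_expand) auto
      have "f q x = (\<Sum>b\<in>B. (x \<bullet> b) *\<^sub>R f q b)"
        by (subst x[symmetric]) (simp add: linear_sum[OF assms(2)] linear_scale[OF assms(2)])
      also have "norm \<dots> \<le> (\<Sum>b\<in>B. norm x * norm (f q b))"
      proof (rule sum_norm_le)
        fix b assume "b \<in> B"
        have "\<bar>x \<bullet> b\<bar> \<le> norm x"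
          using Cauchy_Schwarz_ineq2[of x b] B(3)[OF \<open>b \<in> B\<close>] by simp
        then show "norm ((x \<bullet> b) *\<^sub>R f q b) \<le> norm x * norm (f q b)"
          by (simp add: mult_right_mono)
      qed
      also have "\<dots> = norm x * (\<Sum>b\<in>B. norm (f q b))" by (simp add: sum_distrib_left)
      also have "\<dots> \<le> norm x * e" using elim by (intro mult_left_mono) auto
      finally show "norm (f q x) \<le> e * norm x" by (simp only: mult.commute)
    qed
  qed
qed

lemma spectral_subspaces_disjoint:
  fixes M N :: "real^'n^'n"
  assumes "N ** M = mat 1" "M ** N = mat 1"
    and "x \<in> spectral_subspace M {\<mu>. cmod \<mu> < 1}" "x \<in> spectral_subspace M {\<mu>. cmod \<mu> > 1}"
  shows "x = 0"
proof -
  let ?U = "spectral_subspace M {\<mu>. cmod \<mu> > 1}"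
  have lin: "linear ((*v) N ^^ q)" for q
  proof (induction q)
    case (Suc q)
    then show ?case using linear_compose[OF Suc matrix_vector_mul_linear[of N]] by (simp add: o_def)
  qed (simp add: linear_id[unfolded id_def] id_def)
  have "(\<lambda>x. M *v x) ` ?U = ?U"
    using spectral_subspace_conjugate[OF assms(2,1), of M "{\<mu>. cmod \<mu> > 1}"] assms(2)
    by (simp add: matrix_mul_assoc[symmetric])
  then have "((*v) M ^^ q) x \<in> ?U" for q
    using assms(4) by (induction q) auto
  moreover have "eventually (\<lambda>q. \<forall>y\<in>?U. norm (((*v) N ^^ q) y) \<le> 1 * norm y) sequentially"
    using expanded_spectral_subspace[OF assms(1,2)]
    by (intro uniformly_small_on_subspace subspace_spectral_subspace lin) auto
  moreover have "((*v) N ^^ q) (((*v) M ^^ q) x) = x" for q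
  proof (induction q)
    case (Suc q)
    have "((*v) N ^^ Suc q) (((*v) M ^^ Suc q) x) = ((*v) N ^^ q) (N *v (M *v (((*v) M ^^ q) x)))"
      by (simp only: funpow_Suc_right[of q "(*v) N"] funpow.simps(2)[of q "(*v) M"] o_apply)
    then show ?case using Suc assms(1) by (simp add: matrix_vector_mul_assoc)
  qed simp
  ultimately have "eventually (\<lambda>q. norm x \<le> norm (((*v) M ^^ q) x)) sequentially"
    by (metis (mono_tags, lifting) eventually_mono mult_1)
  moreover have "(\<lambda>q. norm (((*v) M ^^ q) x)) \<longlonglongrightarrow> 0"
    using contracted_spectral_subspace[OF assms(3)] by (rule tendsto_norm_zero)
  ultimately have "norm x \<le> 0"
    by (intro tendsto_lowerbound[where F = sequentially]) auto
  then show ?thesis by simp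
qed

section \<open>The operator norm\<close>

lemma norm_mult_vec_le: "norm (M *v x) \<le> op_norm M * norm x"
  unfolding op_norm_def by (rule onorm) simp

lemma op_norm_le: "(\<And>x. norm (M *v x) \<le> b * norm x) \<Longrightarrow> op_norm M \<le> b"
  unfolding op_norm_def by (rule onorm_le)

lemma op_norm_gt_witness: "b < op_norm M \<Longrightarrow> \<exists>x. norm (M *v x) > b * norm x"
  by (meson op_norm_le not_le)

lemma op_norm_nonneg [simp]: "0 \<le> op_norm M"
  unfolding op_norm_def by (rule onorm_pos_le) simp

lemma op_norm_zero [simp]: "op_norm 0 = 0"
  by (simp add: op_norm_def onorm_zero)

lemma op_norm_eq_0 [simp]: "op_norm M = 0 \<longleftrightarrow> M = 0"
  by (simp add: op_norm_def onorm_eq_0 matrix_eq)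

lemma op_norm_mult: "op_norm (M ** N) \<le> op_norm M * op_norm N"
proof (rule op_norm_le)
  fix x
  have "norm ((M ** N) *v x) \<le> op_norm M * norm (N *v x)"
    by (simp add: matrix_vector_mul_assoc[symmetric] norm_mult_vec_le)
  also have "\<dots> \<le> op_norm M * (op_norm N * norm x)"
    by (intro mult_left_mono norm_mult_vec_le op_norm_nonneg)
  finally show "norm ((M ** N) *v x) \<le> op_norm M * op_norm N * norm x" by (simp only: mult.assoc)
qed

lemma op_norm_add: "op_norm (M + N) \<le> op_norm M + op_norm N"
proof (rule op_norm_le)
  fix x
  show "norm ((M + N) *v x) \<le> (op_norm M + op_norm N) * norm x"
    using norm_triangle_le[OF add_mono[OF norm_mult_vec_le[of M x] norm_mult_vec_le[of N x]]]
    by (simp add: matrix_vector_mult_add_rdistrib algebra_simps)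
qed

lemma scaleR_mult_vec: "(c *\<^sub>R M) *v x = c *\<^sub>R (M *v x)" for M :: "real^'n^'m"
  by (simp add: vec_eq_iff matrix_vector_mult_def sum_distrib_left mult.assoc)

lemma uminus_mult_vec: "(- M) *v x = - (M *v x)" for M :: "real^'n^'m"
  using scaleR_mult_vec[of "-1" M x] by simp

lemma scaleR_matrix_mult:
  "(c *\<^sub>R M) ** N = c *\<^sub>R (M ** N)" "M ** (c *\<^sub>R N) = c *\<^sub>R (M ** N)"
  for M :: "real^'n^'m" and N :: "real^'k^'n"
  by (simp_all add: vec_eq_iff matrix_matrix_mult_def sum_distrib_left mult_ac)

lemma op_norm_scaleR: "op_norm (c *\<^sub>R M) = \<bar>c\<bar> * op_norm M"
  unfolding op_norm_def scaleR_mult_vec by (rule onorm_scaleR) simp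

lemma op_norm_minus: "op_norm (- M) = op_norm M"
  using op_norm_scaleR[of "-1" M] by simp

lemma op_norm_diff: "op_norm (M - N) \<le> op_norm M + op_norm N"
  using op_norm_add[of M "- N"] by (simp add: op_norm_minus)

lemma matrix_distribs:
  "A ** (B + C) = A ** B + A ** C" "(B + C) ** A = B ** A + C ** A"
  "A ** (B - C) = A ** B - A ** C" "(B - C) ** A = B ** A - C ** A"
  "A ** (- B) = - (A ** B)" "(- B) ** A = - (B ** A)"
  for A B C :: "real^'n^'n"
  by (simp_all add: vec_eq_iff matrix_matrix_mult_def algebra_simps sum.distrib sum_subtractf sum_negf)

section \<open>Periodic quasi-modes\<close>

text \<open>The sets \<open>V i\<close> will consist of the \<open>L\<close> for which \<open>1 + t L\<close> is a legitimate change of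
  coordinates at time \<open>i\<close>. In the new coordinates the cocycle has moved by the defect of equivariance,
  so \<open>\<delta>\<close> is the allowed size of the perturbation, whereas the value above \<open>\<kappa>\<close> is the slope that
  tilts the unstable space.\<close>

definition quasi_mode ::
  "nat \<Rightarrow> (int \<Rightarrow> real^'n^'n) \<Rightarrow> (int \<Rightarrow> (real^'n^'n) set) \<Rightarrow> real \<Rightarrow> real \<Rightarrow>
   (int \<Rightarrow> real^'n^'n) \<Rightarrow> bool" where
  "quasi_mode l A V \<delta> \<kappa> L \<longleftrightarrow>
     (\<forall>i. L (i + int l) = L i \<and> L i \<in> V i \<and> op_norm (L (i + 1) ** A i - A i ** L i) \<le> \<delta>) \<and>
     (\<exists>j. op_norm (L j) > \<kappa>)"

text \<open>The orbit \<open>\<Lambda>\<close>, started at time \<open>a\<close> and weighted by \<open>h\<close>, is wrapped around the period: all of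
  its times in one residue class contribute to the same matrix.\<close>

definition periodize ::
  "nat \<Rightarrow> nat \<Rightarrow> int \<Rightarrow> (nat \<Rightarrow> real) \<Rightarrow> (nat \<Rightarrow> real^'n^'n) \<Rightarrow> int \<Rightarrow> real^'n^'n" where
  "periodize l n a h \<Lambda> i = (\<Sum>k<n. if int l dvd a + int k - i then h k *\<^sub>R \<Lambda> k else 0)"

lemma periodize_periodic: "periodize l n a h \<Lambda> (i + int l) = periodize l n a h \<Lambda> i"
proof -
  have "int l dvd x - int l \<longleftrightarrow> int l dvd x" for x
    by (metis diff_add_cancel dvd_add dvd_diff dvd_refl)
  then have "int l dvd a + int k - (i + int l) \<longleftrightarrow> int l dvd a + int k - i" for k
    by (metis diff_diff_eq)
  then show ?thesis by (simp add: periodize_def)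
qed

lemma periodic_congruent:
  fixes f :: "int \<Rightarrow> 'a"
  assumes "\<And>i. f (i + int l) = f i" "int l dvd i - j"
  shows "f i = f j"
proof -
  have nat_shift: "f (i + int m * int l) = f i" for i m
  proof (induction m)
    case (Suc m)
    then show ?case using assms(1)[of "i + int m * int l"] by (simp add: algebra_simps)
  qed simp
  obtain c where c: "i - j = int l * c" using assms(2) by blast
  show ?thesis
  proof (cases "c \<ge> 0")
    case True
    then show ?thesis using nat_shift[of j "nat c"] c by (simp add: algebra_simps)
  next
    case False
    then show ?thesis using nat_shift[of i "nat (- c)"] c by (simp add: algebra_simps)
  qed
qed

lemma periodize_linear:
  "periodize l n a (\<lambda>k. c * h k + d * g k) \<Lambda> i
     = c *\<^sub>R periodize l n a h \<Lambda> i + d *\<^sub>R periodize l n a g \<Lambda> i"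
  unfolding periodize_def scaleR_sum_right sum.distrib[symmetric]
  by (intro sum.cong) (auto simp: algebra_simps)

lemma periodize_in_subspace:
  assumes "\<And>i. subspace (V i)" "\<And>i. V (i + int l) = V i" "\<And>k. \<Lambda> k \<in> V (a + int k)"
  shows "periodize l n a h \<Lambda> i \<in> V i"
  unfolding periodize_def
proof (intro subspace_sum assms(1))
  fix k
  show "(if int l dvd a + int k - i then h k *\<^sub>R \<Lambda> k else 0) \<in> V i"
    using periodic_congruent[where f = V, OF assms(2), of "a + int k" i] assms(1)[of i] assms(3)[of k]
    by (auto intro: subspace_scale subspace_0)
qed

text \<open>Summation by parts: an equivariant sequence, weighted and wrapped around the period, fails to
  be equivariant only through the increments of the weights and through its two ends.\<close>

lemma periodize_defect:
  fixes A :: "int \<Rightarrow> real^'n^'n"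
  assumes "\<And>i. A (i + int l) = A i" "\<And>k. \<Lambda> (Suc k) ** A (a + int k) = A (a + int k) ** \<Lambda> k"
  shows "periodize l n a h \<Lambda> (i + 1) ** A i - A i ** periodize l n a h \<Lambda> i
    = A i ** periodize l n a (\<lambda>k. h (Suc k) - h k) \<Lambda> i
      + (if int l dvd a - (i + 1) then h 0 *\<^sub>R (\<Lambda> 0 ** A i) else 0)
      - (if int l dvd a + int n - (i + 1) then h n *\<^sub>R (\<Lambda> n ** A i) else 0)"
proof (induction n)
  case 0
  then show ?case by (simp add: periodize_def)
next
  case (Suc n)
  have step: "\<Lambda> (Suc n) ** A i = A i ** \<Lambda> n" if "int l dvd a + int n - i"
    using periodic_congruent[where f = A, OF assms(1) that] assms(2)[of n] by simp
  have eq: "a + int (Suc n) - (i + 1) = a + int n - i" by simp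
  show ?case
    using Suc step unfolding eq
    by (auto simp: periodize_def matrix_distribs scaleR_matrix_mult
        algebra_simps split: if_splits)
qed

lemma periodize_defect_norm:
  fixes A :: "int \<Rightarrow> real^'n^'n"
  assumes "\<And>i. A (i + int l) = A i" "\<And>k. \<Lambda> (Suc k) ** A (a + int k) = A (a + int k) ** \<Lambda> k"
    and "\<And>i. op_norm (A i) \<le> C"
  shows "op_norm (periodize l n a h \<Lambda> (i + 1) ** A i - A i ** periodize l n a h \<Lambda> i)
    \<le> C * (op_norm (periodize l n a (\<lambda>k. h (Suc k) - h k) \<Lambda> i)
         + \<bar>h 0\<bar> * op_norm (\<Lambda> 0) + \<bar>h n\<bar> * op_norm (\<Lambda> n))"
proof -
  have C: "0 \<le> C" using order_trans[OF op_norm_nonneg assms(3)] .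
  have m: "op_norm (A i ** X) \<le> C * op_norm X" "op_norm (X ** A i) \<le> C * op_norm X" for X
    using order_trans[OF op_norm_mult mult_right_mono[OF assms(3)[of i] op_norm_nonneg[of X]]]
      order_trans[OF op_norm_mult mult_left_mono[OF assms(3)[of i] op_norm_nonneg[of X]]]
    by (simp_all add: mult.commute)
  have s: "op_norm (if b then x *\<^sub>R (X ** A i) else 0) \<le> C * (\<bar>x\<bar> * op_norm X)" for b x X
  proof (cases b)
    case True
    then show ?thesis
      using mult_left_mono[OF m(2)[of X], of "\<bar>x\<bar>"] by (simp add: op_norm_scaleR mult_ac)
  qed (use C in simp)
  show ?thesis
    unfolding periodize_defect[where A = A and l = l and \<Lambda> = \<Lambda> and a = a, OF assms(1,2)]
      distrib_left
    by (intro order_trans[OF op_norm_diff] add_mono order_trans[OF op_norm_add] m s)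
qed

text \<open>Multiplied by \<open>2 sin (x / 2)\<close>, the sum of the \<open>cos (j x)\<close> telescopes.\<close>

lemma sum_cos_roots_of_unity:
  fixes p :: int
  assumes "p \<noteq> 0" "\<bar>p\<bar> < int m"
  shows "(\<Sum>j<m. cos (2 * pi * real j * of_int p / real m)) = 0"
proof -
  have m: "real m > 0" using assms by auto
  define x where "x = 2 * pi * of_int p / real m"
  have tele: "2 * sin (x / 2) * (\<Sum>j<n. cos (real j * x)) = sin ((real n - 1 / 2) * x) + sin (x / 2)" for n
  proof (induction n)
    case (Suc n)
    have "(real (Suc n) - 1 / 2) * x = real n * x + x / 2" "(real n - 1 / 2) * x = real n * x - x / 2"
      by (simp_all add: algebra_simps)
    then show ?case using Suc by (simp add: sin_add sin_diff algebra_simps)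
  qed simp
  have "sin ((real m - 1 / 2) * x) = sin (- (x / 2) + 2 * pi * of_int p)"
    using m by (intro arg_cong[where f = sin]) (simp add: x_def field_simps)
  also have "\<dots> = - sin (x / 2)"
    by (simp only: sin_add sin_int_2pin cos_int_2pin) simp
  finally have "2 * sin (x / 2) * (\<Sum>j<m. cos (real j * x)) = 0"
    using tele[of m] by simp
  moreover have "sin (x / 2) \<noteq> 0"
  proof
    assume "sin (x / 2) = 0"
    then obtain q :: int where "x / 2 = of_int q * pi" by (auto simp: sin_zero_iff_int2)
    then have "of_int p = of_int q * real m" using m by (simp add: x_def field_simps)
    then have "p = q * int m" by (metis of_int_eq_iff of_int_mult of_int_of_nat_eq)
    then show False using assms by (auto simp: abs_mult)
  qed
  ultimately show ?thesis by (simp add: x_def mult_ac)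
qed

lemma periodize_window:
  assumes "n \<le> l" "k < n" "int l dvd a + int k - i"
  shows "periodize l n a h \<Lambda> i = h k *\<^sub>R \<Lambda> k"
proof -
  have "j = k" if "j < n" "int l dvd a + int j - i" for j
  proof -
    have "int l dvd (a + int j - i) - (a + int k - i)"
      using that(2) assms(3) by (rule dvd_diff)
    then have "int l dvd int j - int k" by simp
    moreover from this have "int l dvd int k - int j" by (simp only: dvd_diff_commute)
    ultimately have "\<not> int j - int k > 0" "\<not> int k - int j > 0"
      using zdvd_imp_le[of "int l" "int j - int k"] zdvd_imp_le[of "int l" "int k - int j"]
        that(1) assms(1,2) by linarith+
    then show ?thesis by linarith
  qed
  then have iff: "int l dvd a + int j - i \<longleftrightarrow> j = k" if "j < n" for j
    using assms(3) that by blast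
  have "periodize l n a h \<Lambda> i = (\<Sum>j<n. if j = k then h k *\<^sub>R \<Lambda> k else 0)"
    unfolding periodize_def by (intro sum.cong refl) (simp only: lessThan_iff iff split: if_split, simp)
  then show ?thesis using assms(2) by simp
qed

text \<open>Give the orbit a tent-shaped weight on a window of length \<open>2 r\<close>. As the window fits into the
  period, wrapping it around never adds two terms. The defect is therefore governed by the slope of the
  tent, and the peak in the middle by \<open>r\<close> times the slope.\<close>

lemma quasi_mode_from_moderate_orbit:
  fixes A :: "int \<Rightarrow> real^'n^'n"
  assumes per: "\<And>i. A (i + int l) = A i"
    and orbit: "\<And>k. \<Lambda> (Suc k) ** A (a + int k) = A (a + int k) ** \<Lambda> k"
    and C: "\<And>i. op_norm (A i) \<le> C" "0 < C"
    and V: "\<And>i. subspace (V i)" "\<And>i. V (i + int l) = V i" "\<And>k. \<Lambda> k \<in> V (a + int k)"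
    and r: "0 < r" "2 * r \<le> l"
    and size: "\<And>k. k \<le> 2 * r \<Longrightarrow> op_norm (\<Lambda> k) \<le> d" "0 < d"
    and \<delta>: "0 < \<delta>"
    and large: "\<kappa> < \<delta> / (C * d) * real r * op_norm (\<Lambda> r)"
  shows "\<exists>L. quasi_mode l A V \<delta> \<kappa> L"
proof -
  define \<eta> where "\<eta> = \<delta> / (C * d)"
  have \<eta>: "0 < \<eta>" "C * (\<eta> * d) = \<delta>" using \<delta> C(2) size(2) by (auto simp: \<eta>_def)
  define h where "h k = \<eta> * real (min k (2 * r - k))" for k
  define L where "L = periodize l (2 * r) a h \<Lambda>"
  have "op_norm (L (i + 1) ** A i - A i ** L i) \<le> \<delta>" for i
  proof -
    have "op_norm (periodize l (2 * r) a (\<lambda>k. h (Suc k) - h k) \<Lambda> i) \<le> \<eta> * d"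
    proof (cases "\<exists>k<2 * r. int l dvd a + int k - i")
      case True
      then obtain k where k: "k < 2 * r" "int l dvd a + int k - i" by blast
      have "\<bar>h (Suc k) - h k\<bar> = \<eta> * \<bar>real (min (Suc k) (2 * r - Suc k)) - real (min k (2 * r - k))\<bar>"
        using \<eta>(1) by (simp add: h_def abs_mult right_diff_distrib[symmetric])
      also have "\<dots> \<le> \<eta> * 1"
        using \<eta>(1) k(1) by (intro mult_left_mono) (auto simp: min_def)
      finally have "\<bar>h (Suc k) - h k\<bar> \<le> \<eta>" by simp
      moreover have "op_norm (\<Lambda> k) \<le> d" using size(1) k(1) by simp
      ultimately show ?thesis
        unfolding periodize_window[OF r(2) k] op_norm_scaleR
        using \<eta>(1) by (intro mult_mono) auto
    next
      case False
      then have "periodize l (2 * r) a (\<lambda>k. h (Suc k) - h k) \<Lambda> i = 0"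
        unfolding periodize_def by (intro sum.neutral) auto
      then show ?thesis using \<eta>(1) size(2) by simp
    qed
    moreover have "h 0 = 0" "h (2 * r) = 0" by (simp_all add: h_def)
    ultimately have "C * (op_norm (periodize l (2 * r) a (\<lambda>k. h (Suc k) - h k) \<Lambda> i)
        + \<bar>h 0\<bar> * op_norm (\<Lambda> 0) + \<bar>h (2 * r)\<bar> * op_norm (\<Lambda> (2 * r))) \<le> C * (\<eta> * d)"
      using C(2) by (intro mult_left_mono) simp_all
    with periodize_defect_norm[where A = A and l = l and \<Lambda> = \<Lambda> and a = a and n = "2 * r" and h = h and i = i,
        OF per orbit C(1)] \<eta>(2)
    show ?thesis unfolding L_def by linarith
  qed
  moreover have "op_norm (L (a + int r)) > \<kappa>"
  proof -
    have "L (a + int r) = h r *\<^sub>R \<Lambda> r"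
      unfolding L_def using r by (intro periodize_window) auto
    moreover have "h r = \<eta> * real r" by (simp add: h_def)
    moreover have "\<kappa> < \<eta> * real r * op_norm (\<Lambda> r)" using large by (simp only: \<eta>_def)
    ultimately show ?thesis using \<eta>(1) by (simp add: op_norm_scaleR abs_mult)
  qed
  ultimately show ?thesis
    unfolding quasi_mode_def L_def
    using periodize_periodic periodize_in_subspace[of V, OF V] by blast
qed

lemma sum_mult_vec: "(\<Sum>k\<in>K. f k) *v x = (\<Sum>k\<in>K. f k *v x)" for f :: "'k \<Rightarrow> real^'n^'m"
  by (induction K rule: infinite_finite_induct) (simp_all add: matrix_vector_mult_add_rdistrib)

text \<open>Fourier inversion: the average of these weights over \<open>j\<close> isolates the term at time \<open>b\<close>. Tested
  against a vector on which \<open>\<Lambda> b\<close> attains more than half of its norm, one of the periodizations must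
  be as large as the isolated term, so that wrapping around the period cannot cancel it for every
  \<open>j\<close>.\<close>

lemma exists_frequency_without_cancellation:
  fixes \<Lambda> :: "nat \<Rightarrow> real^'n^'n"
  assumes "b < m * l" "\<Lambda> b \<noteq> 0"
  shows "\<exists>j<m. op_norm (\<Lambda> b) \<le>
    2 * op_norm (periodize l (m * l) a (\<lambda>k. cos (2 * pi * real j / (real m * real l) * (real k - real b))) \<Lambda> (a + int b))"
proof -
  define N where "N = op_norm (\<Lambda> b)"
  have N: "N > 0" using assms(2) by (simp add: N_def less_le)
  have m: "0 < m" "0 < l" using assms(1) by (cases m; cases l; simp)+
  obtain x where x: "norm (\<Lambda> b *v x) > N / 2 * norm x"
    using op_norm_gt_witness[of "N / 2" "\<Lambda> b"] N N_def by auto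
  define y where "y = \<Lambda> b *v x"
  have "0 \<le> N / 2 * norm x" using N by simp
  then have y: "0 < norm y" using x unfolding y_def by linarith
  define F where "F j = periodize l (m * l) a
    (\<lambda>k. cos (2 * pi * real j / (real m * real l) * (real k - real b))) \<Lambda> (a + int b)" for j
  have Fx: "(F j *v x) \<bullet> y = (\<Sum>k<m * l. if int l dvd int k - int b then
      cos (2 * pi * real j / (real m * real l) * (real k - real b)) * ((\<Lambda> k *v x) \<bullet> y) else 0)" for j
    unfolding F_def periodize_def sum_mult_vec inner_sum_left
    by (intro sum.cong) (auto simp: scaleR_mult_vec)
  have isolate: "(\<Sum>j<m. if int l dvd int k - int b then
      cos (2 * pi * real j / (real m * real l) * (real k - real b)) * ((\<Lambda> k *v x) \<bullet> y) else 0)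
      = (if k = b then real m * (norm y)\<^sup>2 else 0)" if k: "k < m * l" for k
  proof (cases "int l dvd int k - int b")
    case True
    then obtain p where p: "int k - int b = int l * p" by blast
    have rp: "real k - real b = real l * of_int p"
      using arg_cong[OF p, of real_of_int] by simp
    have cosp: "cos (2 * pi * real j / (real m * real l) * (real k - real b))
        = cos (2 * pi * real j * of_int p / real m)" for j
    proof -
      have "2 * pi * real j / (real m * real l) * (real l * of_int p) = 2 * pi * real j * of_int p / real m"
        using m by simp
      then show ?thesis unfolding rp by (rule arg_cong)
    qed
    show ?thesis
    proof (cases "k = b")
      case True
      then show ?thesis by (simp add: y_def dot_square_norm)
    next
      case False
      then have "p \<noteq> 0" using p by auto
      have "int l * \<bar>p\<bar> = \<bar>int k - int b\<bar>" using p by (simp add: abs_mult)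
      also have "\<dots> < int m * int l"
      proof -
        have "int k < int m * int l" "int b < int m * int l"
          using k assms(1) by (metis of_nat_less_iff of_nat_mult)+
        then show ?thesis by linarith
      qed
      also have "\<dots> = int l * int m" by (rule mult.commute)
      finally have "\<bar>p\<bar> < int m" using m by simp
      then have "(\<Sum>j<m. cos (2 * pi * real j * of_int p / real m)) = 0"
        using \<open>p \<noteq> 0\<close> by (intro sum_cos_roots_of_unity)
      then show ?thesis
        using True False by (simp only: cosp if_True if_False sum_distrib_right[symmetric] mult_zero_left)
    qed
  next
    case False
    then show ?thesis by auto
  qed
  have "(\<Sum>j<m. (F j *v x) \<bullet> y) = (\<Sum>k<m * l. if k = b then real m * (norm y)\<^sup>2 else 0)"
    unfolding Fx by (subst sum.swap) (rule sum.cong[OF refl isolate], simp only: lessThan_iff)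
  also have "\<dots> = (\<Sum>j<m. (norm y)\<^sup>2)" using assms(1) by simp
  finally have sum_eq: "(\<Sum>j<m. (F j *v x) \<bullet> y) = (\<Sum>j<m. (norm y)\<^sup>2)" .
  have "\<exists>j<m. (norm y)\<^sup>2 \<le> (F j *v x) \<bullet> y"
  proof (rule ccontr)
    assume "\<not> ?thesis"
    then have "(F j *v x) \<bullet> y < (norm y)\<^sup>2" if "j < m" for j
      using that by (meson not_le)
    then have "(\<Sum>j<m. (F j *v x) \<bullet> y) < (\<Sum>j<m. (norm y)\<^sup>2)"
      using m(1) by (intro sum_strict_mono) auto
    then show False by (simp only: sum_eq less_irrefl)
  qed
  then obtain j where j: "j < m" "(norm y)\<^sup>2 \<le> (F j *v x) \<bullet> y" by blast
  have "norm y * norm y \<le> norm (F j *v x) * norm y"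
    using j(2) norm_cauchy_schwarz[of "F j *v x" y] by (simp add: power2_eq_square)
  then have "norm y \<le> norm (F j *v x)" using y by simp
  also have "\<dots> \<le> op_norm (F j) * norm x" by (rule norm_mult_vec_le)
  finally have "N / 2 * norm x < op_norm (F j) * norm x" using x by (simp add: y_def)
  then have "N / 2 < op_norm (F j)" by (rule mult_right_less_imp_less[OF _ norm_ge_zero])
  then show ?thesis using j(1) by (auto simp: F_def N_def)
qed

text \<open>A transient excursion of an orbit yields a quasi-mode however long it lasts compared with the
  period. Periodized with a suitable frequency \<open>\<theta> \<le> 2 \<pi> / l\<close> it is not cancelled at its peak; a step
  in time rotates the cosine and sine periodizations into each other by the angle \<open>\<theta>\<close>, which is small
  for a long period, and the two ends of the orbit are negligible compared with the peak.\<close>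

lemma quasi_mode_from_transient_growth:
  fixes A :: "int \<Rightarrow> real^'n^'n"
  assumes per: "\<And>i. A (i + int l) = A i"
    and orbit: "\<And>k. \<Lambda> (Suc k) ** A (a + int k) = A (a + int k) ** \<Lambda> k"
    and C: "\<And>i. op_norm (A i) \<le> C" "0 < C"
    and V: "\<And>i. subspace (V i)" "\<And>i. V (i + int l) = V i" "\<And>k. \<Lambda> k \<in> V (a + int k)"
    and \<delta>: "0 < \<delta>" "0 < \<kappa>"
    and long: "16 * pi * C * \<kappa> \<le> \<delta> * real l"
    and ends: "op_norm (\<Lambda> (m * l)) \<le> op_norm (\<Lambda> 0)"
    and peak: "b < m * l" "16 * C * \<kappa> * op_norm (\<Lambda> 0) \<le> \<delta> * op_norm (\<Lambda> b)" "\<Lambda> b \<noteq> 0"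
  shows "\<exists>L. quasi_mode l A V \<delta> \<kappa> L"
proof -
  have m: "0 < m" "0 < l" using peak(1) by (cases m; cases l; simp)+
  obtain j where j: "j < m" "op_norm (\<Lambda> b) \<le>
    2 * op_norm (periodize l (m * l) a (\<lambda>k. cos (2 * pi * real j / (real m * real l) * (real k - real b))) \<Lambda> (a + int b))"
    using exists_frequency_without_cancellation[of b m l \<Lambda> a] peak(1,3) by blast
  define \<theta> where "\<theta> = 2 * pi * real j / (real m * real l)"
  have \<theta>: "0 \<le> \<theta>" "\<theta> * real l \<le> 2 * pi" using j(1) m by (auto simp: \<theta>_def field_simps)
  define Fc where "Fc = periodize l (m * l) a (\<lambda>k. cos (\<theta> * (real k - real b))) \<Lambda>"
  define Fs where "Fs = periodize l (m * l) a (\<lambda>k. sin (\<theta> * (real k - real b))) \<Lambda>"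
  define S where "S = Max ((\<lambda>i. max (op_norm (Fc i)) (op_norm (Fs i))) ` {0..<int l})"
  have bound: "op_norm (Fc i) \<le> S" "op_norm (Fs i) \<le> S" for i
  proof -
    have "int l dvd i - i mod int l" by (simp add: minus_mod_eq_mult_div)
    then have "Fc i = Fc (i mod int l)" "Fs i = Fs (i mod int l)"
      by (rule periodic_congruent[of Fc l, rotated] periodic_congruent[of Fs l, rotated];
          simp only: Fc_def Fs_def periodize_periodic)+
    moreover have "max (op_norm (Fc (i mod int l))) (op_norm (Fs (i mod int l))) \<le> S"
      unfolding S_def using m(2) by (intro Max_ge) auto
    ultimately show "op_norm (Fc i) \<le> S" "op_norm (Fs i) \<le> S" by simp_all
  qed
  have Sb: "op_norm (\<Lambda> b) \<le> 2 * S"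
    using j(2) bound(1)[of "a + int b"] by (simp add: Fc_def \<theta>_def)
  have S: "0 < S" using Sb peak(3) op_norm_nonneg[of "\<Lambda> b"] op_norm_eq_0[of "\<Lambda> b"] by linarith
  have defect: "op_norm (periodize l (m * l) a h \<Lambda> (i + 1) ** A i - A i ** periodize l (m * l) a h \<Lambda> i)
      \<le> C * (2 * \<theta> * S + 2 * op_norm (\<Lambda> 0))"
    if h: "\<And>k. \<bar>h k\<bar> \<le> 1" "\<And>k. h (Suc k) - h k = c * cos (\<theta> * (real k - real b)) + d * sin (\<theta> * (real k - real b))"
      and cd: "\<bar>c\<bar> \<le> \<theta>" "\<bar>d\<bar> \<le> \<theta>" for h c d i
  proof -
    have "periodize l (m * l) a (\<lambda>k. h (Suc k) - h k) \<Lambda> i = c *\<^sub>R Fc i + d *\<^sub>R Fs i"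
      unfolding h(2) periodize_linear Fc_def Fs_def ..
    also have "op_norm \<dots> \<le> \<bar>c\<bar> * op_norm (Fc i) + \<bar>d\<bar> * op_norm (Fs i)"
      using op_norm_add[of "c *\<^sub>R Fc i" "d *\<^sub>R Fs i"] by (simp add: op_norm_scaleR)
    also have "\<dots> \<le> \<theta> * S + \<theta> * S"
      using cd bound \<theta>(1) by (intro add_mono mult_mono) auto
    finally have 1: "op_norm (periodize l (m * l) a (\<lambda>k. h (Suc k) - h k) \<Lambda> i) \<le> 2 * \<theta> * S" by (simp add: mult_ac)
    have 2: "\<bar>h 0\<bar> * op_norm (\<Lambda> 0) \<le> 1 * op_norm (\<Lambda> 0)"
      by (intro mult_right_mono h op_norm_nonneg)
    have 3: "\<bar>h (m * l)\<bar> * op_norm (\<Lambda> (m * l)) \<le> 1 * op_norm (\<Lambda> 0)"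
      by (intro mult_mono h ends op_norm_nonneg) simp
    show ?thesis
      by (rule order_trans[OF periodize_defect_norm[where A = A and l = l and \<Lambda> = \<Lambda> and a = a,
              OF per orbit C(1)] mult_left_mono])
        (use 1 2 3 C(2) in simp_all)
  qed
  have small: "\<bar>cos \<theta> - 1\<bar> \<le> \<theta>" "\<bar>sin \<theta>\<bar> \<le> \<theta>"
  proof -
    show "\<bar>sin \<theta>\<bar> \<le> \<theta>" using abs_sin_x_le_abs_x[of \<theta>] \<theta>(1) by simp
    have "\<bar>cos \<theta> - 1\<bar> = 2 * \<bar>sin (\<theta> / 2)\<bar> * \<bar>sin (\<theta> / 2)\<bar>"
      using cos_double_sin[of "\<theta> / 2"] by (simp add: power2_eq_square abs_mult)
    also have "\<dots> \<le> 2 * \<bar>\<theta> / 2\<bar> * 1"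
      by (intro mult_mono abs_sin_x_le_abs_x abs_sin_le_one) auto
    finally show "\<bar>cos \<theta> - 1\<bar> \<le> \<theta>" using \<theta>(1) by simp
  qed
  have shift: "\<theta> * (real (Suc k) - real b) = \<theta> * (real k - real b) + \<theta>" for k
    by (simp add: algebra_simps)
  have dc: "op_norm (Fc (i + 1) ** A i - A i ** Fc i) \<le> C * (2 * \<theta> * S + 2 * op_norm (\<Lambda> 0))" for i
    unfolding Fc_def
    by (rule defect[where c = "cos \<theta> - 1" and d = "- sin \<theta>"])
      (use small in \<open>simp_all only: shift cos_add abs_minus abs_cos_le_one\<close>, simp_all add: algebra_simps)
  have ds: "op_norm (Fs (i + 1) ** A i - A i ** Fs i) \<le> C * (2 * \<theta> * S + 2 * op_norm (\<Lambda> 0))" for i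
    unfolding Fs_def
    by (rule defect[where c = "sin \<theta>" and d = "cos \<theta> - 1"])
      (use small in \<open>simp_all only: shift sin_add abs_minus abs_sin_le_one\<close>, simp_all add: algebra_simps)
  have "S \<in> (\<lambda>i. max (op_norm (Fc i)) (op_norm (Fs i))) ` {0..<int l}"
    unfolding S_def using m(2) by (intro Max_in) auto
  then obtain i0 where "S = op_norm (Fc i0) \<or> S = op_norm (Fs i0)" by (auto simp: max_def)
  then obtain F where F: "F = Fc \<or> F = Fs" "op_norm (F i0) = S" by blast
  \<comment> \<open>Normalized by the joint maximum \<open>S\<close>, so that the larger of the two families peaks at \<open>2 \<kappa>\<close>.\<close>
  define L where "L i = (2 * \<kappa> / S) *\<^sub>R F i" for i
  have FV: "F i \<in> V i" "F (i + int l) = F i" for i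
    using F(1) periodize_in_subspace[of V, OF V] periodize_periodic by (auto simp: Fc_def Fs_def)
  have "op_norm (L (i + 1) ** A i - A i ** L i) \<le> \<delta>" for i
  proof -
    have "op_norm (L (i + 1) ** A i - A i ** L i) = 2 * \<kappa> / S * op_norm (F (i + 1) ** A i - A i ** F i)"
      using S \<delta>(2)
      by (simp add: L_def scaleR_matrix_mult scaleR_diff_right[symmetric] op_norm_scaleR)
    also have "\<dots> \<le> 2 * \<kappa> / S * (C * (2 * \<theta> * S + 2 * op_norm (\<Lambda> 0)))"
      using dc[of i] ds[of i] F(1) S \<delta>(2) by (intro mult_left_mono) auto
    also have "\<dots> = 4 * C * \<kappa> * \<theta> + 4 * C * \<kappa> * op_norm (\<Lambda> 0) / S"
      using S by (simp add: field_simps)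
    also have "\<dots> \<le> \<delta> / 2 + \<delta> / 2"
    proof (rule add_mono)
      have "4 * C * \<kappa> * \<theta> * real l \<le> 4 * C * \<kappa> * (2 * pi)"
        using mult_left_mono[OF \<theta>(2), of "4 * C * \<kappa>"] C(2) \<delta>(2) by (simp add: mult_ac)
      also have "\<dots> \<le> \<delta> / 2 * real l" using long by (simp add: field_simps)
      finally show "4 * C * \<kappa> * \<theta> \<le> \<delta> / 2" using m(2) by simp
      have "16 * C * \<kappa> * op_norm (\<Lambda> 0) \<le> \<delta> * (2 * S)"
        using peak(2) mult_left_mono[OF Sb, of \<delta>] \<delta>(1) by linarith
      then show "4 * C * \<kappa> * op_norm (\<Lambda> 0) / S \<le> \<delta> / 2"
        using S by (simp add: field_simps)
    qed
    finally show ?thesis by simp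
  qed
  moreover have "op_norm (L i0) > \<kappa>"
    using S \<delta>(2) by (simp add: L_def op_norm_scaleR F(2))
  ultimately show ?thesis
    unfolding quasi_mode_def
    using FV V(1) by (intro exI[of _ L] conjI allI exI[of _ i0]) (auto simp: L_def subspace_scale)
qed

section \<open>Invertible and unipotent matrices\<close>

lemma matrix_inv_eqI:
  fixes M N :: "real^'n^'n"
  assumes "M ** N = mat 1" "N ** M = mat 1"
  shows "matrix_inv M = N"
proof -
  have "M ** matrix_inv M = mat 1 \<and> matrix_inv M ** M = mat 1"
    unfolding matrix_inv_def using assms by (intro someI_ex[of "\<lambda>N. M ** N = mat 1 \<and> N ** M = mat 1"]) blast
  then have "N ** (M ** matrix_inv M) = N" "matrix_inv M ** M = mat 1" by simp_all
  then show ?thesis by (simp add: matrix_mul_assoc assms(2))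
qed

lemma matrix_inv_works:
  fixes M :: "real^'n^'n"
  assumes "invertible M"
  shows "M ** matrix_inv M = mat 1" "matrix_inv M ** M = mat 1"
  using assms matrix_inv_eqI[of M] unfolding invertible_def by metis+

lemma matrix_inv_vec:
  fixes M :: "real^'n^'n"
  assumes "invertible M"
  shows "M *v (matrix_inv M *v x) = x" "matrix_inv M *v (M *v x) = x"
  using matrix_inv_works[OF assms] by (simp_all add: matrix_vector_mul_assoc)

lemma exists_projection_matrix:
  fixes V :: "(real^'n) set"
  assumes "subspace V"
  shows "\<exists>P :: real^'n^'n. (\<forall>x. P *v x \<in> V) \<and> (\<forall>x\<in>V. P *v x = x)"
proof -
  obtain B where B: "B \<subseteq> V" "pairwise orthogonal B" "\<And>x. x \<in> B \<Longrightarrow> norm x = 1"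
    "independent B" "span B = V"
    using orthonormal_basis_subspace[OF assms] by metis
  have fin: "finite B" using B(4) by (simp add: independent_imp_finite)
  define f where "f x = (\<Sum>b\<in>B. (x \<bullet> b) *\<^sub>R b)" for x
  have "linear f"
    by (rule linearI) (simp_all add: f_def inner_add_left algebra_simps sum.distrib scaleR_sum_right)
  then have mf: "matrix f *v x = f x" for x by simp
  show ?thesis
  proof (intro exI[of _ "matrix f"] conjI allI ballI)
    fix x
    show "matrix f *v x \<in> V"
      unfolding mf f_def using B(1) by (auto intro!: subspace_sum subspace_scale assms)
    show "matrix f *v x = x" if "x \<in> V"
      unfolding mf f_def using B that fin by (intro orthonormal_basis_expand) auto
  qed
qed

text \<open>The reflection \<open>R = 1 - 2 P\<close>, with \<open>P\<close> a projection onto the range of \<open>L\<close>, conjugates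
  \<open>1 + L\<close> to its inverse \<open>1 - L\<close>; so the determinant squares to one for every such \<open>L\<close>. It
  is one because \<open>1 + L\<close> is the square of \<open>1 + L / 2\<close>.\<close>

lemma det_unipotent:
  fixes L :: "real^'n^'n"
  assumes "L ** L = 0"
  shows "det (mat 1 + L) = 1"
proof -
  have sq: "det (mat 1 + X) * det (mat 1 + X) = 1" if X: "X ** X = 0" for X :: "real^'n^'n"
  proof -
    obtain P where P: "\<And>x. P *v x \<in> range ((*v) X)" "\<And>x. x \<in> range ((*v) X) \<Longrightarrow> P *v x = x"
      using exists_projection_matrix[of "range ((*v) X)"] subspace_UNIV linear_subspace_image
      by (metis matrix_vector_mul_linear)
    have PX: "P ** X = X"
      by (simp add: matrix_eq matrix_vector_mul_assoc[symmetric] P(2))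
    have XP: "X ** P = 0"
    proof -
      have "X *v (P *v x) = 0" for x
      proof -
        obtain z where "P *v x = X *v z" using P(1)[of x] by blast
        then show ?thesis using X by (simp add: matrix_vector_mul_assoc)
      qed
      then show ?thesis by (simp add: matrix_eq matrix_vector_mul_assoc[symmetric])
    qed
    have PP: "P ** P = P"
      by (simp add: matrix_eq matrix_vector_mul_assoc[symmetric] P)
    define R where "R = mat 1 - (2::real) *\<^sub>R P"
    have RR: "R ** R = mat 1"
      by (simp add: R_def matrix_distribs scaleR_matrix_mult PP) (simp add: vec_eq_iff)
    have "R ** (mat 1 + X) = R - X"
      by (simp add: R_def matrix_distribs scaleR_matrix_mult PX) (simp add: vec_eq_iff)
    then have "R ** (mat 1 + X) ** R = mat 1 - X"
      using RR by (simp add: matrix_distribs) (simp add: R_def matrix_distribs scaleR_matrix_mult XP)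
    then have "det R * det (mat 1 + X) * det R = det (mat 1 - X)" by (metis det_mul)
    moreover have "det R * det R = 1" using RR by (metis det_mul det_I)
    ultimately have "det (mat 1 - X) = det (mat 1 + X)"
      by (metis mult.assoc mult.commute mult_1)
    moreover have "(mat 1 + X) ** (mat 1 - X) = mat 1"
      by (simp add: matrix_distribs X)
    ultimately show ?thesis by (metis det_mul det_I)
  qed
  define X where "X = (1 / 2 :: real) *\<^sub>R L"
  have "X ** X = 0" by (simp add: X_def scaleR_matrix_mult assms)
  moreover from this have "(mat 1 + X) ** (mat 1 + X) = mat 1 + L"
    by (simp add: matrix_distribs) (simp add: X_def vec_eq_iff)
  ultimately show ?thesis using sq[of X] by (metis det_mul)
qed

section \<open>Hyperbolic cocycles\<close>

lemma cocycle_prod_add: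
  "cocycle_prod A i (m + n) = cocycle_prod A (i + int m) n ** cocycle_prod A i m"
  by (induction n) (simp_all add: matrix_mul_assoc add.assoc)

lemma cocycle_prod_Suc_right: "cocycle_prod A i (Suc n) = cocycle_prod A (i + 1) n ** A i"
  using cocycle_prod_add[of A i 1 n] by simp

locale hyperbolic_cocycle =
  fixes l :: nat and A :: "int \<Rightarrow> real^'n^'n"
  assumes l_pos: "1 \<le> l"
    and periodic: "A (i + int l) = A i"
    and invertible_A: "invertible (A i)"
    and hyp: "hyperbolic l A"
begin

abbreviation "E \<equiv> stable_space l A"
abbreviation "U \<equiv> unstable_space l A"

lemma prod_periodic: "cocycle_prod A (i + int l) n = cocycle_prod A i n"
proof (induction n)
  case (Suc n)
  then show ?case using periodic[of "i + int n"] by (simp add: algebra_simps)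
qed simp

lemma invertible_prod: "invertible (cocycle_prod A i n)"
proof (induction n)
  case 0
  show ?case unfolding invertible_def by (intro exI[of _ "mat 1"]) simp
qed (simp add: invertible_mult invertible_A)

text \<open>All invariance properties of the stable and unstable spaces come from this conjugacy.\<close>

lemma period_map_conjugate:
  "cocycle_prod A (i + 1) l = A i ** cocycle_prod A i l ** matrix_inv (A i)"
proof -
  have "cocycle_prod A (i + 1) l ** A i = A i ** cocycle_prod A i l"
    using cocycle_prod_Suc_right[of A i l] periodic[of i] by simp
  then have "cocycle_prod A (i + 1) l ** (A i ** matrix_inv (A i)) = A i ** cocycle_prod A i l ** matrix_inv (A i)"
    by (simp add: matrix_mul_assoc)
  then show ?thesis by (simp add: matrix_inv_works[OF invertible_A])
qed

lemma E_step: "E (i + 1) = (\<lambda>x. A i *v x) ` E i" and U_step: "U (i + 1) = (\<lambda>x. A i *v x) ` U i"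
  unfolding stable_space_def unstable_space_def period_map_conjugate
  by (rule spectral_subspace_conjugate; rule matrix_inv_works[OF invertible_A])+

lemma E_prod: "E (i + int n) = (\<lambda>x. cocycle_prod A i n *v x) ` E i"
proof (induction n)
  case (Suc n)
  then show ?case using E_step[of "i + int n"]
    by (simp add: image_image matrix_vector_mul_assoc algebra_simps)
qed simp

lemma E_periodic: "E (i + int l) = E i" and U_periodic: "U (i + int l) = U i"
  by (simp_all add: stable_space_def unstable_space_def prod_periodic)

lemma subspace_E: "subspace (E i)" and subspace_U: "subspace (U i)"
  by (simp_all add: stable_space_def unstable_space_def subspace_spectral_subspace)

lemma eigenvalue_period_map: "eigenvalue (cocycle_prod A i l) \<mu> \<longleftrightarrow> eigenvalue (cocycle_prod A 1 l) \<mu>"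
proof -
  have step: "eigenvalue (cocycle_prod A (i + 1) l) \<mu> \<longleftrightarrow> eigenvalue (cocycle_prod A i l) \<mu>" for i
    unfolding period_map_conjugate
    by (rule eigenvalue_conjugate_iff; rule matrix_inv_works[OF invertible_A])
  show ?thesis
  proof (induction i rule: int_induct[where k = 1])
    case (step1 i)
    then show ?case using step[of i] by blast
  next
    case (step2 i)
    then show ?case using step[of "i - 1"] by simp
  qed simp
qed

lemma decompose: "\<exists>u\<in>E i. \<exists>v\<in>U i. x = u + v"
  unfolding stable_space_def unstable_space_def
  using hyp by (intro real_vector_decomposition) (auto simp: hyperbolic_def eigenvalue_period_map[of i])

lemma disjoint_E_U: "E i \<inter> U i = {0}"
  using spectral_subspaces_disjoint[OF matrix_inv_works(2,1)[OF invertible_prod[of i l]]]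
    subspace_0[OF subspace_E] subspace_0[OF subspace_U]
  by (auto simp: stable_space_def unstable_space_def)

lemma invariant_splitting_E_U:
  assumes "\<And>i. E i \<noteq> {0} \<and> U i \<noteq> {0}"
  shows "invariant_splitting A E U"
  unfolding invariant_splitting_def
  using assms subspace_E subspace_U disjoint_E_U decompose E_step U_step by metis

lemma prod_power: "cocycle_prod A i (q * l) *v x = ((*v) (cocycle_prod A i l) ^^ q) x"
proof (induction q)
  case (Suc q)
  have "cocycle_prod A (i + int (q * l)) l = cocycle_prod A i l"
    by (rule periodic_congruent[where l = l]) (simp_all add: prod_periodic)
  then show ?case
    using Suc cocycle_prod_add[of A i "q * l" l] by (simp add: matrix_vector_mul_assoc[symmetric] add.commute)
qed simp

lemma inverse_prod_power:
  "matrix_inv (cocycle_prod A i (q * l)) *v x = ((*v) (matrix_inv (cocycle_prod A i l)) ^^ q) x"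
proof -
  let ?M = "cocycle_prod A i l" and ?N = "matrix_inv (cocycle_prod A i l)"
  have cancel: "((*v) ?N ^^ q) (((*v) ?M ^^ q) y) = y" for y
  proof (induction q)
    case (Suc q)
    have "((*v) ?N ^^ Suc q) (((*v) ?M ^^ Suc q) y) = ((*v) ?N ^^ q) (?N *v (?M *v (((*v) ?M ^^ q) y)))"
      by (simp only: funpow_Suc_right[of q "(*v) ?N"] funpow.simps(2)[of q "(*v) ?M"] o_apply)
    then show ?case using Suc by (simp only: matrix_inv_vec[OF invertible_prod])
  qed simp
  have "((*v) ?N ^^ q) x = ((*v) ?N ^^ q) (cocycle_prod A i (q * l) *v (matrix_inv (cocycle_prod A i (q * l)) *v x))"
    by (simp only: matrix_inv_vec[OF invertible_prod])
  then show ?thesis by (simp only: prod_power[of i q] cancel)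
qed

lemma E_contracted:
  assumes "e > 0"
  shows "eventually (\<lambda>q. \<forall>x\<in>E i. norm (cocycle_prod A i (q * l) *v x) \<le> e * norm x) sequentially"
  using contracted_spectral_subspace[of _ "cocycle_prod A i l"] assms
  by (intro uniformly_small_on_subspace subspace_E matrix_vector_mul_linear) (simp_all add: prod_power stable_space_def)

lemma U_expanded:
  assumes "e > 0"
  shows "eventually (\<lambda>q. \<forall>x\<in>U i. norm (matrix_inv (cocycle_prod A i (q * l)) *v x) \<le> e * norm x) sequentially"
  using expanded_spectral_subspace[OF matrix_inv_works(2,1)[OF invertible_prod[of i l]]] assms
  by (intro uniformly_small_on_subspace subspace_U matrix_vector_mul_linear) (simp_all add: inverse_prod_power unstable_space_def)

text \<open>The matrices that are strictly block triangular for the splitting.\<close>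

definition triangular :: "int \<Rightarrow> (real^'n^'n) set" where
  "triangular i = {X. (\<forall>x\<in>E i. X *v x = 0) \<and> (\<forall>x. X *v x \<in> E i)}"

lemma triangular_periodic: "triangular (i + int l) = triangular i"
  by (simp add: triangular_def E_periodic)

lemma subspace_triangular: "subspace (triangular i)"
  using subspace_0[OF subspace_E[of i]] subspace_add[OF subspace_E[of i]] subspace_scale[OF subspace_E[of i]]
  by (auto simp: subspace_def triangular_def matrix_vector_mult_add_rdistrib scaleR_mult_vec)

definition transport :: "int \<Rightarrow> real^'n^'n \<Rightarrow> nat \<Rightarrow> real^'n^'n" where
  "transport a X k = cocycle_prod A a k ** X ** matrix_inv (cocycle_prod A a k)"

lemma transport_0 [simp]: "transport a X 0 = X"
  by (simp add: transport_def matrix_inv_eqI[of "mat 1" "mat 1"])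

lemma transport_vec:
  "transport a X k *v x = cocycle_prod A a k *v (X *v (matrix_inv (cocycle_prod A a k) *v x))"
  by (simp add: transport_def matrix_vector_mul_assoc[symmetric])

lemma transport_Suc: "transport a X (Suc k) ** A (a + int k) = A (a + int k) ** transport a X k"
proof -
  let ?P = "cocycle_prod A a k"
  have "(transport a X (Suc k) ** A (a + int k)) *v x = (A (a + int k) ** transport a X k) *v x" for x
  proof -
    have "cocycle_prod A a (Suc k) *v (matrix_inv ?P *v x) = A (a + int k) *v x"
      by (simp add: matrix_vector_mul_assoc[symmetric] matrix_inv_vec[OF invertible_prod])
    then have "matrix_inv (cocycle_prod A a (Suc k)) *v (A (a + int k) *v x) = matrix_inv ?P *v x"
      using matrix_inv_vec(2)[OF invertible_prod[of a "Suc k"]] by metis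
    then show ?thesis
      unfolding matrix_vector_mul_assoc[symmetric] transport_vec by (simp add: matrix_vector_mul_assoc[symmetric])
  qed
  then show ?thesis by (simp add: matrix_eq)
qed

lemma transport_add: "transport (a + int m) (transport a X m) n = transport a X (m + n)"
proof -
  let ?P = "cocycle_prod A a m" and ?Q = "cocycle_prod A (a + int m) n"
  have "matrix_inv (?Q ** ?P) = matrix_inv ?P ** matrix_inv ?Q"
    by (rule matrix_inv_eqI)
      (simp_all add: matrix_eq matrix_vector_mul_assoc[symmetric] matrix_inv_vec[OF invertible_prod])
  then show ?thesis by (simp add: transport_def cocycle_prod_add matrix_mul_assoc)
qed

lemma inverse_prod_E: "x \<in> E (a + int k) \<Longrightarrow> matrix_inv (cocycle_prod A a k) *v x \<in> E a"
  using E_prod[of a k] by (auto simp: matrix_inv_vec[OF invertible_prod])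

lemma transport_triangular:
  assumes "X \<in> triangular a"
  shows "transport a X k \<in> triangular (a + int k)"
  using assms inverse_prod_E by (auto simp: triangular_def transport_vec E_prod)

text \<open>A vector of the sum splits with a bounded unstable part, on which the inverse period maps
  contract; the period maps then contract the value of \<open>X\<close>.\<close>

lemma transport_eventually_small:
  assumes "X \<in> triangular a" "0 < s"
    and transversal: "\<And>x w. x \<in> E a \<Longrightarrow> w \<in> U a \<Longrightarrow> s * norm w \<le> norm (x + w)"
  shows "eventually (\<lambda>q. op_norm (transport a X (q * l)) \<le> op_norm X) sequentially"
  using E_contracted[OF assms(2), of a] U_expanded[OF zero_less_one, of a]
proof eventually_elim
  case (elim q)
  let ?P = "cocycle_prod A a (q * l)"
  have EU: "E (a + int (q * l)) = E a"
    by (rule periodic_congruent[where l = l]; simp add: E_periodic)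
  show ?case
  proof (rule op_norm_le)
    fix x
    obtain e w where ew: "e \<in> E a" "w \<in> U a" "x = e + w" using decompose[of a x] by blast
    have "X *v (matrix_inv ?P *v e) = 0"
      using inverse_prod_E[of e a "q * l", unfolded EU] assms(1) ew(1) by (simp add: triangular_def)
    then have "transport a X (q * l) *v x = ?P *v (X *v (matrix_inv ?P *v w))"
      by (simp add: transport_vec ew(3) matrix_vector_right_distrib)
    also have "norm \<dots> \<le> s * norm (X *v (matrix_inv ?P *v w))"
      using elim(1) assms(1) by (simp add: triangular_def)
    also have "\<dots> \<le> s * (op_norm X * norm (matrix_inv ?P *v w))"
      using assms(2) by (intro mult_left_mono norm_mult_vec_le) simp
    also have "\<dots> \<le> s * (op_norm X * (1 * norm w))"
      using elim(2) ew(2) assms(2) by (intro mult_left_mono) auto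
    also have "\<dots> = op_norm X * (s * norm w)" by simp
    also have "\<dots> \<le> op_norm X * norm x"
      unfolding ew(3) by (intro mult_left_mono transversal ew op_norm_nonneg)
    finally show "norm (transport a X (q * l) *v x) \<le> op_norm X * norm x" .
  qed
qed

end

section \<open>Angles\<close>

lemma vector_angle_argument:
  "- 1 \<le> (u \<bullet> v) / (norm u * norm v)" "(u \<bullet> v) / (norm u * norm v) \<le> 1"
proof -
  have "\<bar>(u \<bullet> v) / (norm u * norm v)\<bar> \<le> 1"
  proof (cases "norm u * norm v = 0")
    case False
    then show ?thesis
      using Cauchy_Schwarz_ineq2[of u v] by (simp add: abs_mult divide_le_eq_1)
  qed auto
  then show "- 1 \<le> (u \<bullet> v) / (norm u * norm v)" "(u \<bullet> v) / (norm u * norm v) \<le> 1"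
    by linarith+
qed

lemma vector_angle_range: "0 \<le> vector_angle u v" "vector_angle u v \<le> pi"
  unfolding vector_angle_def
  using arccos_lbound[OF vector_angle_argument] arccos_ubound[OF vector_angle_argument] by blast+

lemma cos_vector_angle: "cos (vector_angle u v) = (u \<bullet> v) / (norm u * norm v)"
  unfolding vector_angle_def by (rule cos_arccos[OF vector_angle_argument])

lemma subspace_angle_le:
  assumes "u \<in> E - {0}" "v \<in> F - {0}"
  shows "subspace_angle E F \<le> vector_angle u v"
proof -
  have "bdd_below {vector_angle u v | u v. u \<in> E - {0} \<and> v \<in> F - {0}}"
    by (intro bdd_belowI[of _ 0]) (auto simp: vector_angle_range)
  then show ?thesis
    unfolding subspace_angle_def using assms by (intro cInf_lower) auto
qed

lemma transversal_if_angle_ge: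
  assumes "subspace E" "0 < \<epsilon>" "\<epsilon> \<le> 1" "\<epsilon> \<le> subspace_angle E F" "x \<in> E" "w \<in> F"
  shows "sin \<epsilon> * norm w \<le> norm (x + w)" "sin \<epsilon> * norm x \<le> norm (x + w)"
proof -
  have eps: "\<epsilon> \<le> pi" using assms(3) pi_gt3 by linarith
  have s: "0 \<le> sin \<epsilon>" "sin \<epsilon> \<le> 1" using assms(2) eps by (auto intro: sin_ge_zero)
  have c: "0 \<le> cos \<epsilon>" using assms(2,3) pi_gt3 by (intro cos_ge_zero) auto
  have "- (x \<bullet> w) \<le> cos \<epsilon> * (norm x * norm w)"
  proof (cases "x = 0 \<or> w = 0")
    case False
    then have "\<epsilon> \<le> vector_angle (- x) w"
      using assms subspace_angle_le[of "- x" E w F] subspace_neg[OF assms(1)] by fastforce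
    then have "cos (vector_angle (- x) w) \<le> cos \<epsilon>"
      using assms(2) by (intro cos_monotone_0_pi_le vector_angle_range) auto
    then have "- (x \<bullet> w) / (norm x * norm w) \<le> cos \<epsilon>"
      by (simp add: cos_vector_angle)
    moreover have "0 < norm x * norm w" using False by simp
    ultimately show ?thesis using pos_divide_le_eq by blast
  qed auto
  moreover have "(norm (x + w))\<^sup>2 = (norm x)\<^sup>2 + (norm w)\<^sup>2 + 2 * (x \<bullet> w)"
    by (simp add: power2_norm_eq_inner inner_add_left inner_add_right inner_commute)
  ultimately have ge: "(norm (x + w))\<^sup>2 \<ge> (norm x)\<^sup>2 + (norm w)\<^sup>2 - 2 * cos \<epsilon> * (norm x * norm w)"
    by linarith
  have cs: "(cos \<epsilon>)\<^sup>2 = 1 - (sin \<epsilon>)\<^sup>2" by (simp add: cos_squared_eq)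
  have "(norm x)\<^sup>2 + (norm w)\<^sup>2 - 2 * cos \<epsilon> * (norm x * norm w)
      = (norm x - cos \<epsilon> * norm w)\<^sup>2 + (sin \<epsilon> * norm w)\<^sup>2"
    by (simp add: power2_diff power_mult_distrib cs algebra_simps)
  then have "(sin \<epsilon> * norm w)\<^sup>2 \<le> (norm (x + w))\<^sup>2" using ge by (smt (verit) zero_le_power2)
  then show "sin \<epsilon> * norm w \<le> norm (x + w)" by (rule power2_le_imp_le) simp
  have "(norm x)\<^sup>2 + (norm w)\<^sup>2 - 2 * cos \<epsilon> * (norm x * norm w)
      = (norm w - cos \<epsilon> * norm x)\<^sup>2 + (sin \<epsilon> * norm x)\<^sup>2"
    by (simp add: power2_diff power_mult_distrib cs algebra_simps)
  then have "(sin \<epsilon> * norm x)\<^sup>2 \<le> (norm (x + w))\<^sup>2" using ge by (smt (verit) zero_le_power2)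
  then show "sin \<epsilon> * norm x \<le> norm (x + w)" by (rule power2_le_imp_le) simp
qed

lemma vector_angle_small:
  fixes a w :: "real^'n"
  assumes "0 < \<epsilon>" "\<epsilon> \<le> 1" "2 * norm w < (1 - cos \<epsilon>) * norm a"
  shows "a + w \<noteq> 0" "vector_angle a (a + w) < \<epsilon>"
proof -
  have c: "0 \<le> cos \<epsilon>" using assms(1,2) pi_gt3 by (intro cos_ge_zero) auto
  have c1: "cos \<epsilon> \<le> 1" by simp
  have "(1 - cos \<epsilon>) * norm a \<le> 1 * norm a" using c by (intro mult_right_mono) auto
  then have wa: "norm w < norm a" using assms(3) norm_ge_zero[of w] by linarith
  then show nz: "a + w \<noteq> 0" by (metis add.inverse_inverse add_eq_0_iff norm_minus_cancel less_irrefl)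
  have a0: "0 < norm a" using wa norm_ge_zero[of w] by linarith
  have "cos \<epsilon> * (norm a + norm w) \<le> cos \<epsilon> * norm a + norm w"
    using mult_right_mono[OF c1 norm_ge_zero[of w]] by (simp add: distrib_left)
  also have "\<dots> < norm a - norm w" using assms(3) by (simp add: left_diff_distrib)
  finally have "cos \<epsilon> * norm (a + w) < norm a - norm w"
    using mult_left_mono[OF norm_triangle_ineq[of a w] c] by linarith
  then have "norm a * (cos \<epsilon> * norm (a + w)) < norm a * (norm a - norm w)"
    using a0 by (rule mult_strict_left_mono)
  also have "\<dots> \<le> a \<bullet> (a + w)"
    using Cauchy_Schwarz_ineq2[of a w]
    by (simp add: inner_add_right dot_square_norm power2_eq_square right_diff_distrib)
  finally have "cos \<epsilon> < (a \<bullet> (a + w)) / (norm a * norm (a + w))"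
    using a0 nz by (simp add: pos_less_divide_eq mult_ac)
  then have "vector_angle a (a + w) < arccos (cos \<epsilon>)"
    unfolding vector_angle_def
    by (intro arccos_less_arccos vector_angle_argument(2)) simp
  also have "arccos (cos \<epsilon>) = \<epsilon>" using assms(1,2) pi_gt3 by (intro arccos_cos) auto
  finally show "vector_angle a (a + w) < \<epsilon>" .
qed

section \<open>From a quasi-mode to the perturbation\<close>

definition reaches_small_angle ::
  "(real^'n^'n) set \<Rightarrow> real \<Rightarrow> nat \<Rightarrow> (int \<Rightarrow> real^'n^'n) \<Rightarrow> bool" where
  "reaches_small_angle G \<epsilon> l A \<longleftrightarrow>
     (\<exists>B. perturbation_path G \<epsilon> l A B \<and>
          (\<forall>t\<in>{0..1}. hyperbolic l (B t)) \<and>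
          (\<exists>j\<in>{1..int l}.
             stable_space l (B 1) j \<noteq> {0} \<and> unstable_space l (B 1) j \<noteq> {0} \<and>
             subspace_angle (stable_space l (B 1) j) (unstable_space l (B 1) j) < \<epsilon>))"

text \<open>The set \<open>\<g>\<close> stands for the Lie algebra of \<open>G\<close>: unipotent changes of coordinates in \<open>G\<close> are
  to be found in \<open>1 + \<g>\<close>, and conjugation by the cocycle must respect it.\<close>

locale group_cocycle = hyperbolic_cocycle l A
  for l :: nat and A :: "int \<Rightarrow> real^'n^'n" +
  fixes G \<g> :: "(real^'n^'n) set" and C :: real
  assumes in_G: "A i \<in> G"
    and G_mult: "M \<in> G \<Longrightarrow> N \<in> G \<Longrightarrow> M ** N \<in> G"
    and subspace_Lie: "subspace \<g>"
    and G_unipotent: "X \<in> \<g> \<Longrightarrow> X ** X = 0 \<Longrightarrow> mat 1 + X \<in> G"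
    and Lie_conjugate: "X \<in> \<g> \<Longrightarrow> M \<in> G \<Longrightarrow> invertible M \<Longrightarrow> M ** X ** matrix_inv M \<in> \<g>"
    and bound: "op_norm (A i) \<le> C" "op_norm (matrix_inv (A i)) \<le> C" "1 < C"
begin

definition tangent :: "int \<Rightarrow> (real^'n^'n) set" where
  "tangent i = triangular i \<inter> \<g>"

lemma subspace_tangent: "subspace (tangent i)"
  unfolding tangent_def by (intro subspace_inter subspace_triangular subspace_Lie)

lemma tangent_periodic: "tangent (i + int l) = tangent i"
  by (simp add: tangent_def triangular_periodic)

lemma prod_in_G: "cocycle_prod A i n \<in> G"
proof (induction n)
  case 0
  show ?case using G_unipotent[of 0] subspace_0[OF subspace_Lie] by simp
qed (simp add: G_mult in_G)

lemma transport_tangent: "X \<in> tangent a \<Longrightarrow> transport a X k \<in> tangent (a + int k)"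
  unfolding tangent_def
  using transport_triangular Lie_conjugate[OF _ prod_in_G invertible_prod] by (auto simp: transport_def)

text \<open>Conjugating the cocycle by \<open>1 + t L\<close> keeps all eigenvalues and moves each factor by \<open>t\<close> times
  the defect of \<open>L\<close>; the quadratic terms vanish because everything is strictly triangular. At
  \<open>t = 1\<close> the unstable space has become the graph of \<open>L\<close>, which is steep where \<open>L\<close> is large.\<close>

lemma reaches_small_angle_if_quasi_mode:
  assumes \<epsilon>: "0 < \<epsilon>" "\<epsilon> \<le> 1" and s: "0 < s"
    and transversal: "\<And>i x w. x \<in> E i \<Longrightarrow> w \<in> U i \<Longrightarrow> s * norm w \<le> norm (x + w)"
    and L: "quasi_mode l A tangent (\<epsilon> / (2 * C\<^sup>2)) (2 / (s * (1 - cos \<epsilon>))) L"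
  shows "reaches_small_angle G \<epsilon> l A"
proof -
  let ?AI = "\<lambda>i. matrix_inv (A i)"
  have L_per: "L (i + int l) = L i" and L_tan: "L i \<in> triangular i" "L i \<in> \<g>"
    and L_def: "op_norm (L (i + 1) ** A i - A i ** L i) \<le> \<epsilon> / (2 * C\<^sup>2)" for i
    using L by (auto simp: quasi_mode_def tangent_def)
  have L_E: "L i *v x = 0" if "x \<in> E i" for i x using L_tan(1)[of i] that by (simp add: triangular_def)
  have L_range: "L i *v x \<in> E i" for i x using L_tan(1)[of i] by (simp add: triangular_def)
  have A_E: "A i *v x \<in> E (i + 1)" if "x \<in> E i" for i x using that by (simp add: E_step)
  have AI_E: "?AI i *v x \<in> E i" if "x \<in> E (i + 1)" for i x
    using that by (auto simp: E_step matrix_inv_vec[OF invertible_A])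
  have zero: "L i ** L i = 0" "L (i + 1) ** A i ** L i = 0" "L i ** ?AI i ** L (i + 1) = 0" for i
    by (simp_all add: matrix_eq matrix_vector_mul_assoc[symmetric] L_E L_range A_E AI_E)
  define P where "P t i = mat 1 + t *\<^sub>R L i" for t i
  define Q where "Q t i = mat 1 + (- t) *\<^sub>R L i" for t i
  have PQ: "P t i ** Q t i = mat 1" "Q t i ** P t i = mat 1" for t i
    by (simp_all add: P_def Q_def matrix_distribs scaleR_matrix_mult zero)
  have P_G: "P t i \<in> G" and Q_G: "Q t i \<in> G" for t i
    unfolding P_def Q_def
    by (intro G_unipotent subspace_scale[OF subspace_Lie] L_tan; simp only: scaleR_matrix_mult zero scaleR_zero_right)+
  have P_per: "P t (i + int l) = P t i" for t i by (simp add: P_def L_per)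
  define D where "D i = L (i + 1) ** A i - A i ** L i" for i
  define B where "B t i = P t (i + 1) ** A i ** Q t i" for t i
  have B_eq: "B t i = A i + t *\<^sub>R D i" for t i
    by (simp add: B_def P_def Q_def D_def matrix_distribs scaleR_matrix_mult zero scaleR_diff_right)
  have B_inv: "matrix_inv (B t i) = ?AI i - t *\<^sub>R (?AI i ** D i ** ?AI i)" for t i
  proof -
    have "matrix_inv (B t i) = P t i ** ?AI i ** Q t (i + 1)"
    proof (rule matrix_inv_eqI)
      show "B t i ** (P t i ** ?AI i ** Q t (i + 1)) = mat 1"
        using PQ by (simp add: matrix_eq B_def matrix_vector_mul_assoc[symmetric] matrix_inv_vec[OF invertible_A])
      show "(P t i ** ?AI i ** Q t (i + 1)) ** B t i = mat 1"
        using PQ by (simp add: matrix_eq B_def matrix_vector_mul_assoc[symmetric] matrix_inv_vec[OF invertible_A])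
    qed
    also have "\<dots> = ?AI i + t *\<^sub>R (L i ** ?AI i - ?AI i ** L (i + 1))"
      by (simp add: P_def Q_def matrix_distribs scaleR_matrix_mult zero scaleR_diff_right)
    also have "L i ** ?AI i - ?AI i ** L (i + 1) = - (?AI i ** D i ** ?AI i)"
      by (simp add: D_def matrix_eq uminus_mult_vec matrix_vector_mul_assoc[symmetric] matrix_vector_mult_diff_rdistrib
          matrix_vector_mult_diff_distrib matrix_inv_vec[OF invertible_A])
    finally show ?thesis by simp
  qed
  have prod_B: "cocycle_prod (B t) i n = P t (i + int n) ** cocycle_prod A i n ** Q t i" for t i n
  proof (induction n)
    case 0
    then show ?case by (simp add: PQ)
  next
    case (Suc n)
    have "cocycle_prod (B t) i (Suc n) = P t (i + int n + 1) ** A (i + int n)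
        ** (Q t (i + int n) ** P t (i + int n)) ** cocycle_prod A i n ** Q t i"
      unfolding cocycle_prod.simps Suc B_def by (simp only: matrix_mul_assoc)
    then show ?case by (simp add: PQ matrix_mul_assoc add_ac)
  qed
  have period_B: "cocycle_prod (B t) i l = P t i ** cocycle_prod A i l ** Q t i" for t i
    by (simp add: prod_B P_per)
  have E_B: "stable_space l (B t) i = (\<lambda>x. P t i *v x) ` E i"
    and U_B: "unstable_space l (B t) i = (\<lambda>x. P t i *v x) ` U i" for t i
    unfolding stable_space_def unstable_space_def period_B
    by (rule spectral_subspace_conjugate; rule PQ)+
  have hyp_B: "hyperbolic l (B t)" for t
    using hyp unfolding hyperbolic_def period_B by (simp add: eigenvalue_conjugate_iff[OF PQ])
  have C2: "1 < C\<^sup>2" using bound(3) by (simp add: one_less_power)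
  have path: "perturbation_path G \<epsilon> l A B"
    unfolding perturbation_path_def periodic_cocycle_def
  proof (intro conjI ballI allI)
    fix t :: real and i assume t: "t \<in> {0..1}"
    show "B t i \<in> G" by (simp add: B_def G_mult P_G Q_G in_G)
    show "B t (i + int l) = B t i"
      using L_per[of "i + 1"] by (simp add: B_eq D_def periodic L_per add_ac)
    have tD: "t * op_norm (D i) \<le> \<epsilon> / (2 * C\<^sup>2)"
      using t mult_left_le_one_le[of "op_norm (D i)" t] L_def[of i] by (simp add: D_def)
    have half: "C\<^sup>2 * (\<epsilon> / (2 * C\<^sup>2)) < \<epsilon>" using C2 \<epsilon>(1) by simp
    have "op_norm (A i - B t i) = t * op_norm (D i)"
      using t by (simp add: B_eq op_norm_minus op_norm_scaleR)
    also have "\<dots> \<le> C\<^sup>2 * (\<epsilon> / (2 * C\<^sup>2))"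
      using tD C2 \<epsilon>(1) by (intro order_trans[OF tD]) (simp add: divide_le_eq)
    finally have 1: "op_norm (A i - B t i) < \<epsilon>" using half by linarith
    have conj: "op_norm (?AI i ** D i ** ?AI i) \<le> C * op_norm (D i) * C"
      using bound(3) by (intro order_trans[OF op_norm_mult] mult_mono bound op_norm_nonneg) auto
    have "op_norm (?AI i - matrix_inv (B t i)) = t * op_norm (?AI i ** D i ** ?AI i)"
      using t by (simp add: B_inv op_norm_scaleR)
    also have "\<dots> \<le> t * (C * op_norm (D i) * C)"
      using t by (intro mult_left_mono conj) simp
    also have "t * (C * op_norm (D i) * C) = C\<^sup>2 * (t * op_norm (D i))"
      by (simp add: power2_eq_square)
    also have "\<dots> \<le> C\<^sup>2 * (\<epsilon> / (2 * C\<^sup>2))" by (intro mult_left_mono tD) simp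
    finally have 2: "op_norm (?AI i - matrix_inv (B t i)) < \<epsilon>" using half by linarith
    show "max (op_norm (A i - B t i)) (op_norm (matrix_inv (A i) - matrix_inv (B t i))) < \<epsilon>"
      using 1 2 by simp
  next
    fix i
    show "continuous_on {0..1} (\<lambda>t. B t i)" unfolding B_eq by (intro continuous_intros)
  qed (use l_pos in \<open>auto simp: B_eq\<close>)
  obtain j0 where j0: "op_norm (L j0) > 2 / (s * (1 - cos \<epsilon>))"
    using L by (auto simp: quasi_mode_def)
  define j where "j = (j0 - 1) mod int l + 1"
  have "(j0 - 1) mod int l < int l" "0 \<le> (j0 - 1) mod int l" using l_pos by simp_all
  then have j: "j \<in> {1..int l}" unfolding j_def atLeastAtMost_iff by linarith
  have "j0 - j = (j0 - 1) - (j0 - 1) mod int l" by (simp add: j_def)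
  then have "int l dvd j0 - j" by (simp only: dvd_minus_mod)
  then have "L j0 = L j" by (rule periodic_congruent[where l = l, rotated]) (rule L_per)
  then obtain x where x: "norm (L j *v x) > 2 / (s * (1 - cos \<epsilon>)) * norm x"
    using op_norm_gt_witness j0 by metis
  obtain e w where ew: "e \<in> E j" "w \<in> U j" "x = e + w" using decompose[of j x] by blast
  define a where "a = L j *v w"
  have c1: "0 < 1 - cos \<epsilon>"
    using cos_monotone_0_pi[of 0 \<epsilon>] \<epsilon> pi_gt3 by simp
  have "s * norm w \<le> norm x" unfolding ew(3) by (rule transversal[OF ew(1,2)])
  moreover have La: "L j *v x = a" by (simp add: ew(3) matrix_vector_right_distrib L_E[OF ew(1)] a_def)
  moreover have "2 * norm x < norm a * (s * (1 - cos \<epsilon>))"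
    using x s c1 unfolding La by (simp add: pos_divide_less_eq mult_ac)
  ultimately have "s * (2 * norm w) < s * ((1 - cos \<epsilon>) * norm a)" by (simp add: mult_ac)
  then have steep: "2 * norm w < (1 - cos \<epsilon>) * norm a" using s by simp
  have aE: "a \<in> E j" unfolding a_def by (rule L_range)
  have a0: "a \<noteq> 0" using steep norm_ge_zero[of w] by auto
  have "a \<in> stable_space l (B 1) j"
    unfolding E_B by (rule image_eqI[OF _ aE]) (simp add: P_def matrix_vector_mult_add_rdistrib scaleR_mult_vec L_E[OF aE])
  moreover have "a + w \<in> unstable_space l (B 1) j"
    unfolding U_B by (rule image_eqI[OF _ ew(2)])
      (simp add: P_def matrix_vector_mult_add_rdistrib scaleR_mult_vec a_def add.commute)
  ultimately have aw: "a \<in> stable_space l (B 1) j - {0}" "a + w \<in> unstable_space l (B 1) j - {0}"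
    using a0 vector_angle_small(1)[OF \<epsilon> steep] by auto
  have "subspace_angle (stable_space l (B 1) j) (unstable_space l (B 1) j) < \<epsilon>"
    using subspace_angle_le[OF aw] vector_angle_small(2)[OF \<epsilon> steep] by linarith
  then show ?thesis
    unfolding reaches_small_angle_def using path hyp_B j aw by blast
qed

text \<open>If some orbit of tangent matrices grows by more than the factor \<open>K\<close>, this excursion gives a
  quasi-mode. Otherwise \<open>K\<close> bounds the growth of all orbits between any two times. For the surviving
  orbit this gives an upper bound at every time and, compared with its size at time \<open>n\<close>, a lower
  bound up to that time; so it is of moderate size on the window \<open>[0, 2 r]\<close>.\<close>

lemma reaches_small_angle_if_orbit_survives:
  assumes \<epsilon>: "0 < \<epsilon>" "\<epsilon> \<le> 1" and s: "0 < s"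
    and transversal: "\<And>i x w. x \<in> E i \<Longrightarrow> w \<in> U i \<Longrightarrow> s * norm w \<le> norm (x + w)"
    and \<delta>: "\<delta> = \<epsilon> / (2 * C\<^sup>2)" and \<kappa>: "\<kappa> = 2 / (s * (1 - cos \<epsilon>))" and K: "K = 16 * C * \<kappa> / \<delta>"
    and l: "16 * pi * C * \<kappa> \<le> \<delta> * real l" "2 * r \<le> l"
    and r: "0 < r" "\<kappa> * C * K\<^sup>2 < \<delta> * c * real r" and c: "0 < c"
    and survives: "X \<in> tangent a" "X \<noteq> 0" "2 * r \<le> n" "c * op_norm X \<le> op_norm (transport a X n)"
  shows "reaches_small_angle G \<epsilon> l A"
proof -
  have pos: "0 < \<delta>" "0 < \<kappa>" "0 < C" "0 < K"
  proof -
    have "0 < 1 - cos \<epsilon>" using cos_monotone_0_pi[of 0 \<epsilon>] \<epsilon> pi_gt3 by simp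
    then show "0 < \<kappa>" using s by (simp add: \<kappa>)
    show "0 < C" using bound(3) by simp
    then show "0 < \<delta>" using \<epsilon>(1) by (simp add: \<delta>)
    then show "0 < K" using \<open>0 < \<kappa>\<close> \<open>0 < C\<close> by (simp add: K)
  qed
  have "\<exists>L. quasi_mode l A tangent \<delta> \<kappa> L"
  proof (cases "\<exists>a Y b. Y \<in> tangent a \<and> K * op_norm Y < op_norm (transport a Y b)")
    case True
    then obtain a Y b where Y: "Y \<in> tangent a" "K * op_norm Y < op_norm (transport a Y b)" by blast
    have "eventually (\<lambda>q. op_norm (transport a Y (q * l)) \<le> op_norm Y) sequentially"
      using Y(1) s transversal by (intro transport_eventually_small[where s = s]) (auto simp: tangent_def)
    then have "eventually (\<lambda>q. op_norm (transport a Y (q * l)) \<le> op_norm Y \<and> b < q) sequentially"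
      using eventually_gt_at_top by (rule eventually_conj)
    then obtain q where q: "op_norm (transport a Y (q * l)) \<le> op_norm Y" "b < q"
      by (metis (mono_tags, lifting) eventually_sequentially order_refl)
    have b: "b < q * l" using q(2) l_pos by (metis less_le_trans mult.right_neutral mult_le_mono2)
    have nz: "transport a Y b \<noteq> 0"
    proof
      assume "transport a Y b = 0"
      then have "K * op_norm Y < 0" using Y(2) by simp
      moreover have "0 \<le> K * op_norm Y" using pos(4) by simp
      ultimately show False by linarith
    qed
    have "16 * C * \<kappa> * op_norm Y = \<delta> * (K * op_norm Y)" using pos(1) by (simp add: K)
    also have "\<dots> \<le> \<delta> * op_norm (transport a Y b)" using Y(2) pos(1) by (intro mult_left_mono) auto
    finally show ?thesis
      using q(1) b nz l(1) pos
      by (intro quasi_mode_from_transient_growth[where \<Lambda> = "transport a Y" and a = a and m = q and b = b and C = C])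
        (simp_all add: periodic transport_Suc bound subspace_tangent tangent_periodic transport_tangent Y)
  next
    case False
    then have growth: "op_norm (transport a Y b) \<le> K * op_norm Y" if "Y \<in> tangent a" for a Y b
      using that by (meson not_le)
    have X0: "0 < op_norm X" using survives(2) by (simp add: less_le)
    have "transport a X n = transport (a + int r) (transport a X r) (n - r)"
      using survives(3) by (simp add: transport_add)
    then have "c * op_norm X \<le> K * op_norm (transport a X r)"
      using survives(4) growth[OF transport_tangent[OF survives(1)]] by (metis order_trans)
    then have "\<delta> * real r * (c * op_norm X) \<le> \<delta> * real r * (K * op_norm (transport a X r))"
      using pos(1) by (intro mult_left_mono) auto
    moreover have "\<kappa> * C * K\<^sup>2 * op_norm X < \<delta> * c * real r * op_norm X"
      using r(2) X0 by (rule mult_strict_right_mono)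
    ultimately have "K * (\<kappa> * (C * (K * op_norm X))) < K * (\<delta> * real r * op_norm (transport a X r))"
      by (simp add: power2_eq_square mult_ac)
    then have "\<kappa> * (C * (K * op_norm X)) < \<delta> * real r * op_norm (transport a X r)"
      using pos(4) by simp
    then have "\<kappa> < \<delta> / (C * (K * op_norm X)) * real r * op_norm (transport a X r)"
      using pos X0 by (simp add: pos_less_divide_eq)
    then show ?thesis
      using r(1) l(2) pos X0
      by (intro quasi_mode_from_moderate_orbit[where \<Lambda> = "transport a X" and a = a and r = r and d = "K * op_norm X" and C = C])
        (simp_all add: periodic transport_Suc bound subspace_tangent tangent_periodic transport_tangent survives(1) growth)
  qed
  then obtain L where "quasi_mode l A tangent \<delta> \<kappa> L" by blast
  then show ?thesis
    unfolding \<delta> \<kappa> using transversal by (rule reaches_small_angle_if_quasi_mode[OF \<epsilon> s, rotated])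
qed

end

section \<open>Orbits that survive without domination\<close>

lemma rank_one_vec: "matrix (\<lambda>x. (\<phi> \<bullet> x) *\<^sub>R u) *v x = (\<phi> \<bullet> x) *\<^sub>R u" for u \<phi> :: "real^'n"
proof -
  have "linear (\<lambda>x. (\<phi> \<bullet> x) *\<^sub>R u)"
    by (rule linearI) (simp_all add: inner_add_right scaleR_add_left)
  then show ?thesis by simp
qed

lemma op_norm_rank_one: "op_norm (matrix (\<lambda>x. (\<phi> \<bullet> x) *\<^sub>R u)) = norm \<phi> * norm u"
  for u \<phi> :: "real^'n"
proof (rule antisym)
  show "op_norm (matrix (\<lambda>x. (\<phi> \<bullet> x) *\<^sub>R u)) \<le> norm \<phi> * norm u"
  proof (rule op_norm_le)
    fix x
    show "norm (matrix (\<lambda>x. (\<phi> \<bullet> x) *\<^sub>R u) *v x) \<le> norm \<phi> * norm u * norm x"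
      using mult_right_mono[OF Cauchy_Schwarz_ineq2[of \<phi> x] norm_ge_zero[of u]]
      by (simp add: rank_one_vec mult_ac)
  qed
  show "norm \<phi> * norm u \<le> op_norm (matrix (\<lambda>x. (\<phi> \<bullet> x) *\<^sub>R u))"
  proof (cases "\<phi> = 0")
    case False
    have "norm \<phi> * norm u * norm \<phi> \<le> op_norm (matrix (\<lambda>x. (\<phi> \<bullet> x) *\<^sub>R u)) * norm \<phi>"
      using norm_mult_vec_le[of "matrix (\<lambda>x. (\<phi> \<bullet> x) *\<^sub>R u)" \<phi>]
      by (simp add: rank_one_vec dot_square_norm power2_eq_square mult_ac)
    then show ?thesis using False by (simp add: mult.commute)
  qed simp
qed

context hyperbolic_cocycle
begin

lemma prod_vec_nonzero: "x \<noteq> 0 \<Longrightarrow> cocycle_prod A i n *v x \<noteq> 0"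
  using matrix_inv_vec(2)[OF invertible_prod[of i n], of x] by (auto simp: matrix_vector_mult_0_right)

text \<open>Send \<open>v\<close> to a multiple of \<open>u\<close> by a functional that is orthogonal to the stable space; then
  compare the images of \<open>u\<close> and \<open>v\<close> after time \<open>n\<close>.\<close>

lemma surviving_triangular_orbit:
  assumes "0 < s"
    and transversal: "\<And>x w. x \<in> E i \<Longrightarrow> w \<in> U i \<Longrightarrow> s * norm w \<le> norm (x + w)"
    and uv: "u \<in> E i" "v \<in> U i" "norm u = 1" "norm v = 1"
    and undominated: "norm (cocycle_prod A i n *v v) \<le> 2 * norm (cocycle_prod A i n *v u)"
  shows "\<exists>X\<in>triangular i. X \<noteq> 0 \<and> s / 2 * op_norm X \<le> op_norm (transport i X n)"
proof -
  obtain p \<phi> where p: "p \<in> E i" "\<And>x. x \<in> E i \<Longrightarrow> \<phi> \<bullet> x = 0" "v = p + \<phi>"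
    using orthogonal_subspace_decomp_exists[of "E i" v] span_base
    by (metis span_eq_iff[THEN iffD2, OF subspace_E] orthogonal_def)
  have s\<phi>: "s \<le> norm \<phi>"
    using transversal[of "- p" v] subspace_neg[OF subspace_E p(1)] uv p(3) by simp
  define X where "X = matrix (\<lambda>x. (\<phi> \<bullet> x) *\<^sub>R u)"
  have tri: "X \<in> triangular i"
    using p(2) subspace_scale[OF subspace_E uv(1)] by (auto simp: triangular_def X_def rank_one_vec)
  have nX: "op_norm X = norm \<phi>" by (simp add: X_def op_norm_rank_one uv)
  have Xv: "X *v v = (norm \<phi>)\<^sup>2 *\<^sub>R u"
    by (simp add: X_def rank_one_vec p inner_add_right dot_square_norm)
  let ?P = "cocycle_prod A i n"
  have "transport i X n *v (?P *v v) = (norm \<phi>)\<^sup>2 *\<^sub>R (?P *v u)"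
    by (simp add: transport_vec matrix_inv_vec[OF invertible_prod] Xv matrix_vector_mult_scaleR)
  then have "(norm \<phi>)\<^sup>2 * norm (?P *v u) \<le> op_norm (transport i X n) * norm (?P *v v)"
    using norm_mult_vec_le[of "transport i X n" "?P *v v"] by simp
  moreover have "(norm \<phi>)\<^sup>2 * norm (?P *v v) \<le> (norm \<phi>)\<^sup>2 * (2 * norm (?P *v u))"
    using undominated by (intro mult_left_mono) auto
  ultimately have "(norm \<phi>)\<^sup>2 * norm (?P *v v) \<le> (2 * op_norm (transport i X n)) * norm (?P *v v)"
    by linarith
  moreover have "?P *v v \<noteq> 0" using uv(4) by (intro prod_vec_nonzero) auto
  ultimately have "(norm \<phi>)\<^sup>2 \<le> 2 * op_norm (transport i X n)" by simp
  moreover have "s * norm \<phi> \<le> (norm \<phi>)\<^sup>2"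
    using mult_right_mono[OF s\<phi> norm_ge_zero[of \<phi>]] by (simp add: power2_eq_square)
  ultimately have "s / 2 * op_norm X \<le> op_norm (transport i X n)" by (simp add: nX)
  moreover have "X \<noteq> 0" using nX s\<phi> assms(1) op_norm_eq_0[of X] by linarith
  ultimately show ?thesis using tri by blast
qed

end

section \<open>The symplectic group\<close>

text \<open>The form acts as a signed permutation: \<open>p\<close> exchanges the coordinates numbered \<open>k\<close> and
  \<open>k + d / 2\<close>, with opposite signs.\<close>

lemma symplectic_form_action:
  fixes e :: "'n::finite \<Rightarrow> nat"
  assumes "bij_betw e UNIV {..<CARD('n)}" "even CARD('n)"
  shows "\<exists>p \<sigma>. (\<forall>i. p (p i) = i \<and> \<sigma> (p i) = - \<sigma> i \<and> \<sigma> i * \<sigma> i = 1) \<and>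
    (\<forall>x i. (symplectic_form e *v x) $ i = \<sigma> i * x $ p i)"
proof -
  obtain m where m: "CARD('n) = 2 * m" using assms(2) by blast
  have e_lt: "e i < 2 * m" for i using assms(1) m by (auto simp: bij_betw_def)
  have e_inj: "e i = e j \<longleftrightarrow> i = j" for i j using assms(1) by (auto simp: bij_betw_def inj_on_def)
  have "\<exists>j. e j = (if e i < m then e i + m else e i - m)" for i
  proof -
    have "(if e i < m then e i + m else e i - m) \<in> e ` UNIV"
      using assms(1) m e_lt[of i] by (auto simp: bij_betw_def)
    then show ?thesis by (metis imageE)
  qed
  then obtain p where p: "\<And>i. e (p i) = (if e i < m then e i + m else e i - m)" by metis
  define \<sigma> where "\<sigma> i = (if e i < m then 1 else - 1 :: real)" for i
  have entry: "symplectic_form e $ i $ j = (if j = p i then \<sigma> i else 0)" for i j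
  proof (cases "e i < m")
    case True
    then have "e j = e i + m \<longleftrightarrow> j = p i" "e i \<noteq> e j + m"
      using p[of i] e_inj[of j "p i"] by simp_all
    then show ?thesis using True by (simp add: symplectic_form_def m \<sigma>_def)
  next
    case False
    have "e i = e j + m \<longleftrightarrow> e j = e i - m" using False by linarith
    also have "\<dots> \<longleftrightarrow> j = p i" using False p[of i] e_inj[of j "p i"] by simp
    finally have "e i = e j + m \<longleftrightarrow> j = p i" .
    moreover have "e j \<noteq> e i + m" using False e_lt[of j] by linarith
    ultimately show ?thesis using False by (simp add: symplectic_form_def m \<sigma>_def)
  qed
  have "(symplectic_form e *v x) $ i = \<sigma> i * x $ p i" for x i
    by (simp add: matrix_vector_mult_def entry if_distrib[of "\<lambda>c. c * _"] cong: if_cong)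
  moreover have "p (p i) = i" for i
    using p[of "p i"] p[of i] e_lt[of i] e_inj[of "p (p i)" i] by (auto split: if_splits)
  moreover have "\<sigma> (p i) = - \<sigma> i" "\<sigma> i * \<sigma> i = 1" for i
    using p[of i] e_lt[of i] by (auto simp: \<sigma>_def)
  ultimately show ?thesis by blast
qed

lemma inner_transpose: "(transpose M *v x) \<bullet> y = x \<bullet> (M *v y)" for M :: "real^'n^'n"
  by (simp add: dot_lmul_matrix)

lemma Sp_iff: "M \<in> Sp e \<longleftrightarrow> (\<forall>x y. (M *v x) \<bullet> (symplectic_form e *v (M *v y)) = x \<bullet> (symplectic_form e *v y))"
proof -
  have eq: "x \<bullet> ((transpose M ** symplectic_form e ** M) *v y) = (M *v x) \<bullet> (symplectic_form e *v (M *v y))" for x y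
  proof -
    have "x \<bullet> ((transpose M ** symplectic_form e ** M) *v y)
        = (transpose M *v (symplectic_form e *v (M *v y))) \<bullet> x"
      by (subst inner_commute) (simp only: matrix_vector_mul_assoc[symmetric])
    also have "\<dots> = (symplectic_form e *v (M *v y)) \<bullet> (M *v x)" by (rule inner_transpose)
    finally show ?thesis by (simp only: inner_commute)
  qed
  have "M \<in> Sp e \<longleftrightarrow> (\<forall>y. (transpose M ** symplectic_form e ** M) *v y = symplectic_form e *v y)"
    by (simp add: Sp_def matrix_eq)
  also have "\<dots> \<longleftrightarrow> (\<forall>y x. x \<bullet> ((transpose M ** symplectic_form e ** M) *v y) = x \<bullet> (symplectic_form e *v y))"
    by (simp only: vector_eq_ldot)
  finally show ?thesis unfolding eq by blast
qed

text \<open>The Lie algebra of the symplectic group.\<close>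

definition sp :: "('n \<Rightarrow> nat) \<Rightarrow> (real^'n^'n) set" where
  "sp e = {X. \<forall>x y. (X *v x) \<bullet> (symplectic_form e *v y) + x \<bullet> (symplectic_form e *v (X *v y)) = 0}"

text \<open>The infinitesimal transvection along \<open>u\<close>.\<close>

definition transvection :: "('n \<Rightarrow> nat) \<Rightarrow> real^'n \<Rightarrow> real^'n^'n" where
  "transvection e u = matrix (\<lambda>x. ((symplectic_form e *v u) \<bullet> x) *\<^sub>R u)"

context
  fixes e :: "'n::finite \<Rightarrow> nat"
  assumes numbering: "bij_betw e UNIV {..<CARD('n)}" "even CARD('n)"
begin

private abbreviation "J \<equiv> symplectic_form e"

lemma symplectic_form_square: "J *v (J *v x) = - x"
proof -
  obtain p \<sigma> where "\<And>i. p (p i) = i \<and> \<sigma> (p i) = - \<sigma> i \<and> \<sigma> i * \<sigma> i = 1"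
    "\<And>x i. (J *v x) $ i = \<sigma> i * x $ p i"
    using symplectic_form_action[OF numbering] by blast
  then show ?thesis by (simp add: vec_eq_iff mult.assoc[symmetric])
qed

lemma symplectic_form_skew: "x \<bullet> (J *v y) = - ((J *v x) \<bullet> y)"
proof -
  have "CARD('n) div 2 > 0" using numbering(2) zero_less_card_finite[where 'a = 'n] by (metis dvd_div_eq_0_iff gr0I not_gr_zero)
  then have "transpose J = - J"
    by (auto simp: vec_eq_iff transpose_def symplectic_form_def)
  then show ?thesis using inner_transpose[of J x y] by (simp add: uminus_mult_vec)
qed

lemma norm_symplectic_form: "norm (J *v x) = norm x"
  using symplectic_form_skew[of "J *v x" x]
  by (simp add: norm_eq_sqrt_inner symplectic_form_square)

lemma invertible_Sp:
  assumes "M \<in> Sp e"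
  shows "invertible M"
proof -
  have "x = 0" if "M *v x = 0" for x
  proof -
    have "x \<bullet> (J *v (J *v x)) = 0"
      using assms that unfolding Sp_iff by (metis inner_zero_left)
    then show ?thesis by (simp add: symplectic_form_square)
  qed
  then show ?thesis
    using matrix_left_invertible_ker[of M] invertible_left_inverse[of M] by blast
qed

lemma Sp_mult: "M \<in> Sp e \<Longrightarrow> N \<in> Sp e \<Longrightarrow> M ** N \<in> Sp e"
  by (simp add: Sp_iff matrix_vector_mul_assoc[symmetric])

lemma subspace_sp: "subspace (sp e)"
  unfolding subspace_def
proof (intro conjI ballI allI)
  fix X Y c assume X: "X \<in> sp e" 
  show "c *\<^sub>R X \<in> sp e"
    using X by (auto simp: sp_def scaleR_mult_vec matrix_vector_mult_scaleR distrib_left[symmetric])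
  assume Y: "Y \<in> sp e"
  have "(X *v x + Y *v x) \<bullet> (J *v y) + x \<bullet> (J *v (X *v y + Y *v y))
    = ((X *v x) \<bullet> (J *v y) + x \<bullet> (J *v (X *v y))) + ((Y *v x) \<bullet> (J *v y) + x \<bullet> (J *v (Y *v y)))" for x y
    by (simp add: inner_add_left inner_add_right matrix_vector_right_distrib)
  then show "X + Y \<in> sp e"
    using X Y by (simp add: sp_def matrix_vector_mult_add_rdistrib)
qed (simp add: sp_def)

lemma Sp_unipotent:
  assumes "X \<in> sp e" "X ** X = 0"
  shows "mat 1 + X \<in> Sp e"
  unfolding Sp_iff
proof (intro allI)
  fix x y
  have sk: "(X *v x) \<bullet> (J *v y) + x \<bullet> (J *v (X *v y)) = 0" for x y
    using assms(1) by (simp add: sp_def)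
  have "(X *v x) \<bullet> (J *v (X *v y)) = - (x \<bullet> (J *v ((X ** X) *v y)))"
    using sk[of x "X *v y"] by (simp add: matrix_vector_mul_assoc[symmetric])
  then have "(X *v x) \<bullet> (J *v (X *v y)) = 0" by (simp add: assms(2))
  then show "((mat 1 + X) *v x) \<bullet> (J *v ((mat 1 + X) *v y)) = x \<bullet> (J *v y)"
    using sk[of x y]
    by (simp add: matrix_vector_mult_add_rdistrib matrix_vector_right_distrib inner_add_left inner_add_right)
qed

lemma sp_conjugate:
  assumes "X \<in> sp e" "M \<in> Sp e" "invertible M"
  shows "M ** X ** matrix_inv M \<in> sp e"
proof -
  let ?N = "matrix_inv M"
  have pres: "(M *v x) \<bullet> (J *v (M *v y)) = x \<bullet> (J *v y)" for x y
    using assms(2) by (simp add: Sp_iff)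
  have "(M *v (X *v (?N *v x))) \<bullet> (J *v y) = (X *v (?N *v x)) \<bullet> (J *v (?N *v y))"
    "x \<bullet> (J *v (M *v (X *v (?N *v y)))) = (?N *v x) \<bullet> (J *v (X *v (?N *v y)))" for x y
    using pres[of "X *v (?N *v x)" "?N *v y"] pres[of "?N *v x" "X *v (?N *v y)"]
    by (simp_all add: matrix_inv_vec[OF assms(3)])
  then show ?thesis
    using assms(1) by (simp add: sp_def matrix_vector_mul_assoc[symmetric])
qed

lemma transvection_sp: "transvection e u \<in> sp e"
proof -
  have "((J *v u) \<bullet> x) * (u \<bullet> (J *v y)) + ((J *v u) \<bullet> y) * (x \<bullet> (J *v u)) = 0" for x y
    using symplectic_form_skew[of u y] inner_commute[of x "J *v u"] by simp
  then show ?thesis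
    by (simp add: sp_def transvection_def rank_one_vec matrix_vector_mult_scaleR)
qed

lemma op_norm_transvection: "op_norm (transvection e u) = (norm u)\<^sup>2"
  by (simp add: transvection_def op_norm_rank_one norm_symplectic_form power2_eq_square)

lemma transvection_conjugate:
  assumes "M \<in> Sp e"
  shows "M ** transvection e u ** matrix_inv M = transvection e (M *v u)"
proof -
  have "(J *v u) \<bullet> (matrix_inv M *v x) = (J *v (M *v u)) \<bullet> x" for x
  proof -
    have "(M *v u) \<bullet> (J *v x) = u \<bullet> (J *v (matrix_inv M *v x))"
      using assms[unfolded Sp_iff, rule_format, of u "matrix_inv M *v x"]
      by (simp only: matrix_inv_vec[OF invertible_Sp[OF assms]])
    then show ?thesis
      using symplectic_form_skew[of "M *v u" x] symplectic_form_skew[of u "matrix_inv M *v x"] by simp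
  qed
  then show ?thesis
    by (simp add: matrix_eq matrix_vector_mul_assoc[symmetric] transvection_def rank_one_vec
        matrix_vector_mult_scaleR)
qed

end

text \<open>Symplectic cocycles: both spaces are isotropic, as the form is invariant and the vectors tend
  to zero in the future, respectively in the past.\<close>

lemma (in hyperbolic_cocycle) isotropic:
  assumes "\<And>i. A i \<in> Sp e"
  shows "x \<in> E i \<Longrightarrow> y \<in> E i \<Longrightarrow> x \<bullet> (symplectic_form e *v y) = 0"
    and "x \<in> U i \<Longrightarrow> y \<in> U i \<Longrightarrow> x \<bullet> (symplectic_form e *v y) = 0"
proof -
  let ?J = "symplectic_form e"
  have prod_Sp: "cocycle_prod A i n \<in> Sp e" for i n
    by (induction n) (use assms in \<open>auto simp: Sp_iff matrix_vector_mul_assoc[symmetric]\<close>)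
  have zero: "x \<bullet> (?J *v y) = 0"
    if f: "\<And>q. f q x \<bullet> (?J *v f q y) = x \<bullet> (?J *v y)" "(\<lambda>q. f q x) \<longlonglongrightarrow> 0" "(\<lambda>q. f q y) \<longlonglongrightarrow> 0"
    for f :: "nat \<Rightarrow> real^'n \<Rightarrow> real^'n"
  proof -
    have "(\<lambda>q. ?J *v f q y) \<longlonglongrightarrow> ?J *v 0"
      by (intro bounded_linear.tendsto[OF matrix_vector_mul_bounded_linear] f)
    then have "(\<lambda>q. f q x \<bullet> (?J *v f q y)) \<longlonglongrightarrow> 0 \<bullet> (?J *v 0)"
      by (intro tendsto_inner f)
    then show ?thesis unfolding f(1) by (simp add: LIMSEQ_const_iff)
  qed
  show "x \<bullet> (?J *v y) = 0" if "x \<in> E i" "y \<in> E i"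
  proof (rule zero[where f = "\<lambda>q z. cocycle_prod A i (q * l) *v z"])
    show "(\<lambda>q. cocycle_prod A i (q * l) *v x) \<longlonglongrightarrow> 0" "(\<lambda>q. cocycle_prod A i (q * l) *v y) \<longlonglongrightarrow> 0"
      using that contracted_spectral_subspace by (auto simp: prod_power stable_space_def)
  qed (use prod_Sp in \<open>auto simp: Sp_iff\<close>)
  show "x \<bullet> (?J *v y) = 0" if "x \<in> U i" "y \<in> U i"
  proof (rule zero[where f = "\<lambda>q z. matrix_inv (cocycle_prod A i (q * l)) *v z"])
    show "(\<lambda>q. matrix_inv (cocycle_prod A i (q * l)) *v x) \<longlonglongrightarrow> 0"
      "(\<lambda>q. matrix_inv (cocycle_prod A i (q * l)) *v y) \<longlonglongrightarrow> 0"
      using that expanded_spectral_subspace[OF matrix_inv_works(2,1)[OF invertible_prod[of i l]]]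
      by (auto simp: inverse_prod_power unstable_space_def)
    fix q
    show "(matrix_inv (cocycle_prod A i (q * l)) *v x) \<bullet> (?J *v (matrix_inv (cocycle_prod A i (q * l)) *v y)) = x \<bullet> (?J *v y)"
      using prod_Sp[of i "q * l"]
      unfolding Sp_iff by (metis matrix_inv_vec(1)[OF invertible_prod])
  qed
qed

text \<open>In the symplectic case the matrix must be a transvection along a stable vector. Its norm is the
  square of that of the vector, so some stable vector has to survive. If the image of \<open>v\<close> has norm at
  least one, then \<open>u\<close> survives. If it is shorter, a stable vector paired with \<open>v\<close> expands, because the invariant form
  bounds the product of the two norms from below.\<close>

lemma (in hyperbolic_cocycle) surviving_transvection:
  fixes e :: "'n \<Rightarrow> nat"
  assumes numbering: "bij_betw e UNIV {..<CARD('n)}" "even CARD('n)"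
    and Sp: "\<And>i. A i \<in> Sp e" and s: "0 < s" "s \<le> 1"
    and transversal: "\<And>x w. x \<in> E i \<Longrightarrow> w \<in> U i \<Longrightarrow> s * norm x \<le> norm (x + w)"
    and uv: "u \<in> E i" "v \<in> U i" "norm u = 1" "norm v = 1"
    and undominated: "norm (cocycle_prod A i n *v v) \<le> 2 * norm (cocycle_prod A i n *v u)"
  shows "\<exists>X\<in>triangular i \<inter> sp e. X \<noteq> 0 \<and> s\<^sup>2 / 4 * op_norm X \<le> op_norm (transport i X n)"
proof -
  let ?J = "symplectic_form e" and ?P = "cocycle_prod A i n"
  have P_Sp: "?P \<in> Sp e"
    by (induction n) (use Sp in \<open>auto simp: Sp_iff matrix_vector_mul_assoc[symmetric]\<close>)
  have "\<exists>a\<in>E i. a \<noteq> 0 \<and> s / 2 * norm a \<le> norm (?P *v a)"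
  proof (cases "norm (?P *v v) \<ge> 1")
    case True
    then show ?thesis using undominated uv s by (intro bexI[of _ u]) auto
  next
    case False
    obtain a w where aw: "a \<in> E i" "w \<in> U i" "?J *v v = a + w" using decompose[of i "?J *v v"] by blast
    have "a \<bullet> (?J *v v) = (?J *v v) \<bullet> (?J *v v)"
      using isotropic(2)[OF Sp aw(2) uv(2)] by (simp add: aw(3) inner_add_left inner_add_right)
    also have "\<dots> = 1" by (simp add: dot_square_norm norm_symplectic_form[OF numbering] uv)
    finally have pair: "a \<bullet> (?J *v v) = 1" .
    then have "1 = (?P *v a) \<bullet> (?J *v (?P *v v))" using P_Sp by (simp add: Sp_iff)
    also have "\<dots> \<le> norm (?P *v a) * norm (?P *v v)"
      using norm_cauchy_schwarz[of "?P *v a" "?J *v (?P *v v)"]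
      by (simp add: norm_symplectic_form[OF numbering])
    also have "\<dots> \<le> norm (?P *v a) * 1" using False by (intro mult_left_mono) auto
    finally have "1 \<le> norm (?P *v a)" by simp
    moreover have "s * norm a \<le> 1"
      using transversal[OF aw(1,2)] by (simp add: aw(3)[symmetric] norm_symplectic_form[OF numbering] uv)
    moreover have "a \<noteq> 0" using pair by auto
    ultimately show ?thesis using aw(1) s by (intro bexI[of _ a]) auto
  qed
  then obtain a where a: "a \<in> E i" "a \<noteq> 0" "s / 2 * norm a \<le> norm (?P *v a)" by blast
  let ?X = "transvection e a"
  have "(?J *v a) \<bullet> x = 0" if "x \<in> E i" for x
    using isotropic(1)[OF Sp that a(1)] by (simp add: inner_commute)
  then have "?X \<in> triangular i"
    using subspace_scale[OF subspace_E a(1)]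
    by (auto simp: triangular_def transvection_def rank_one_vec)
  moreover have "?X \<in> sp e" by (rule transvection_sp[OF numbering])
  moreover have "?X \<noteq> 0" using op_norm_transvection[OF numbering, of a] a(2) by auto
  moreover have "s\<^sup>2 / 4 * op_norm ?X \<le> op_norm (transport i ?X n)"
    using power_mono[OF a(3), of 2] s
    by (simp add: transport_def transvection_conjugate[OF numbering P_Sp] op_norm_transvection[OF numbering]
        power_mult_distrib power_divide)
  ultimately show ?thesis by blast
qed

section \<open>Cocycles without domination\<close>

lemma constant_path_reaches_small_angle:
  assumes "periodic_cocycle G l A" "hyperbolic l A" "0 < \<epsilon>" "j \<in> {1..int l}"
    and "stable_space l A j \<noteq> {0}" "unstable_space l A j \<noteq> {0}"
    and "subspace_angle (stable_space l A j) (unstable_space l A j) < \<epsilon>"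
  shows "reaches_small_angle G \<epsilon> l A"
  unfolding reaches_small_angle_def perturbation_path_def
  using assms by (intro exI[of _ "\<lambda>t. A"]) auto

lemma reaches_small_angle_mono:
  assumes "reaches_small_angle G \<epsilon> l A" "\<epsilon> \<le> \<epsilon>'"
  shows "reaches_small_angle G \<epsilon>' l A"
proof -
  obtain B j where B: "perturbation_path G \<epsilon> l A B" "\<forall>t\<in>{0..1}. hyperbolic l (B t)" "j \<in> {1..int l}"
    "stable_space l (B 1) j \<noteq> {0}" "unstable_space l (B 1) j \<noteq> {0}"
    "subspace_angle (stable_space l (B 1) j) (unstable_space l (B 1) j) < \<epsilon>"
    using assms(1) unfolding reaches_small_angle_def by blast
  have "perturbation_path G \<epsilon>' l A B"
    using B(1) order_less_le_trans[OF _ assms(2)] unfolding perturbation_path_def by blast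
  then show ?thesis
    unfolding reaches_small_angle_def using B(2-5) order_less_le_trans[OF B(6) assms(2)] by blast
qed

text \<open>For \<open>GL\<close> and \<open>SL\<close> all matrices can be taken as tangent matrices, since unipotent matrices have
  determinant one; the symplectic group requires its Lie algebra. In both cases an undominated pair of
  vectors gives a tangent orbit that survives until time \<open>n\<close>; the constant \<open>s\<^sup>2 / 4\<close> serves both.\<close>

lemma admissible_group_tangent:
  fixes G :: "(real^'n^'n) set"
  assumes "admissible_group G"
  shows "\<exists>\<g> :: (real^'n^'n) set.
    (\<forall>M\<in>G. invertible M) \<and> (\<forall>M\<in>G. \<forall>N\<in>G. M ** N \<in> G) \<and> subspace \<g> \<and>
    (\<forall>X\<in>\<g>. X ** X = 0 \<longrightarrow> mat 1 + X \<in> G) \<and>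
    (\<forall>X\<in>\<g>. \<forall>M\<in>G. invertible M \<longrightarrow> M ** X ** matrix_inv M \<in> \<g>) \<and>
    (\<forall>l A s i u v n. hyperbolic_cocycle l A \<longrightarrow> (\<forall>i. A i \<in> G) \<longrightarrow> 0 < s \<longrightarrow> s \<le> 1 \<longrightarrow>
       (\<forall>x\<in>stable_space l A i. \<forall>w\<in>unstable_space l A i. s * norm w \<le> norm (x + w) \<and> s * norm x \<le> norm (x + w)) \<longrightarrow>
       u \<in> stable_space l A i \<longrightarrow> v \<in> unstable_space l A i \<longrightarrow> norm u = 1 \<longrightarrow> norm v = 1 \<longrightarrow>
       norm (cocycle_prod A i n *v v) \<le> 2 * norm (cocycle_prod A i n *v u) \<longrightarrow>
       (\<exists>X\<in>hyperbolic_cocycle.triangular l A i \<inter> \<g>. X \<noteq> 0 \<and>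
          s\<^sup>2 / 4 * op_norm X \<le> op_norm (hyperbolic_cocycle.transport A i X n)))"
proof -
  have linear_case: "\<exists>X\<in>hyperbolic_cocycle.triangular l A i \<inter> UNIV. X \<noteq> 0 \<and>
          s\<^sup>2 / 4 * op_norm X \<le> op_norm (hyperbolic_cocycle.transport A i X n)"
    if h: "hyperbolic_cocycle l A" "0 < s" "s \<le> 1"
      "\<forall>x\<in>stable_space l A i. \<forall>w\<in>unstable_space l A i. s * norm w \<le> norm (x + w) \<and> s * norm x \<le> norm (x + w)"
      "u \<in> stable_space l A i" "v \<in> unstable_space l A i" "norm u = 1" "norm v = 1"
      "norm (cocycle_prod A i n *v v) \<le> 2 * norm (cocycle_prod A i n *v u)"
    for l and A :: "int \<Rightarrow> real^'n^'n" and s i u v n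
  proof -
    obtain X where X: "X \<in> hyperbolic_cocycle.triangular l A i" "X \<noteq> 0"
      "s / 2 * op_norm X \<le> op_norm (hyperbolic_cocycle.transport A i X n)"
      using hyperbolic_cocycle.surviving_triangular_orbit[OF h(1,2) _ h(5-9)] h(4) by blast
    have "s\<^sup>2 / 4 \<le> s / 2"
      using mult_right_mono[OF h(3), of s] h(2) by (simp add: power2_eq_square)
    then have "s\<^sup>2 / 4 * op_norm X \<le> s / 2 * op_norm X" by (intro mult_right_mono op_norm_nonneg)
    then have "s\<^sup>2 / 4 * op_norm X \<le> op_norm (hyperbolic_cocycle.transport A i X n)"
      using X(3) by (rule order_trans)
    then show ?thesis using X(1,2) by blast
  qed
  have unipotent_invertible: "invertible (mat 1 + X)" if "X ** X = 0" for X :: "real^'n^'n"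
    using det_unipotent[OF that] by (simp add: invertible_det_nz)
  consider "G = GL" | "G = SL" | e where "even CARD('n)" "bij_betw e (UNIV :: 'n set) {..<CARD('n)}" "G = Sp e"
    using assms unfolding admissible_group_def by blast
  then show ?thesis
  proof cases
    case 1
    then show ?thesis
      using linear_case unipotent_invertible
      by (intro exI[of _ UNIV]) (simp add: GL_def invertible_mult)
  next
    case 2
    then show ?thesis
      using linear_case
      by (intro exI[of _ UNIV]) (simp add: SL_def invertible_det_nz det_mul det_unipotent)
  next
    case 3
    note numbering = 3(2,1)
    have symplectic_case: "\<exists>X\<in>hyperbolic_cocycle.triangular l A i \<inter> sp e. X \<noteq> 0 \<and>
          s\<^sup>2 / 4 * op_norm X \<le> op_norm (hyperbolic_cocycle.transport A i X n)"
      if "hyperbolic_cocycle l A" "\<forall>i. A i \<in> Sp e" "0 < s" "s \<le> 1"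
        "\<forall>x\<in>stable_space l A i. \<forall>w\<in>unstable_space l A i. s * norm w \<le> norm (x + w) \<and> s * norm x \<le> norm (x + w)"
        "u \<in> stable_space l A i" "v \<in> unstable_space l A i" "norm u = 1" "norm v = 1"
        "norm (cocycle_prod A i n *v v) \<le> 2 * norm (cocycle_prod A i n *v u)"
      for l and A :: "int \<Rightarrow> real^'n^'n" and s i u v n
      using hyperbolic_cocycle.surviving_transvection[OF that(1) numbering _ that(3,4) _ that(6-10)]
        that(2,5) by blast
    show ?thesis
      unfolding 3(3)
      by (intro exI[of _ "sp e"] conjI ballI impI allI invertible_Sp[OF numbering] Sp_mult[OF numbering]
          subspace_sp[OF numbering] Sp_unipotent[OF numbering] sp_conjugate[OF numbering] symplectic_case)
        simp_all
  qed
qed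

lemma vectors_violating_domination:
  assumes "hyperbolic_cocycle l A"
    and "\<And>i. stable_space l A i \<noteq> {0} \<and> unstable_space l A i \<noteq> {0}"
    and "\<not> dominated_splitting N A (stable_space l A) (unstable_space l A)"
  shows "\<exists>i n u v. N \<le> n \<and> u \<in> stable_space l A i \<and> v \<in> unstable_space l A i \<and> norm u = 1 \<and> norm v = 1 \<and>
    norm (cocycle_prod A i n *v v) \<le> 2 * norm (cocycle_prod A i n *v u)"
proof -
  have "invariant_splitting A (stable_space l A) (unstable_space l A)"
    using hyperbolic_cocycle.invariant_splitting_E_U[OF assms(1)] assms(2) by blast
  then obtain i n u v where "N \<le> n" "u \<in> stable_space l A i" "v \<in> unstable_space l A i"
    "norm u = 1" "norm v = 1"
    "\<not> norm (cocycle_prod A i n *v u) \<le> 1 / 2 * norm (cocycle_prod A i n *v v)"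
    using assms(3) unfolding dominated_splitting_def by blast
  then show ?thesis by (intro exI[of _ i] exI[of _ n] exI[of _ u] exI[of _ v]) simp
qed

theorem theorem4p5:
  fixes C \<epsilon> :: real
  assumes "C > 1" and "\<epsilon> > 0"
  shows "\<exists>T N :: nat. T \<ge> 1 \<and> N \<ge> 1 \<and>
    (\<forall>(G :: (real^'n^'n) set) (l :: nat) (A :: int \<Rightarrow> real^'n^'n).
       admissible_group G \<longrightarrow>
       periodic_cocycle G l A \<longrightarrow>
       hyperbolic l A \<longrightarrow>
       bounded_by C A \<longrightarrow>
       l \<ge> T \<longrightarrow>
       (\<forall>i. stable_space l A i \<noteq> {0} \<and> unstable_space l A i \<noteq> {0}) \<longrightarrow>
       \<not> dominated_splitting N A (stable_space l A) (unstable_space l A) \<longrightarrow>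
       (\<exists>B. perturbation_path G \<epsilon> l A B \<and>
            (\<forall>t\<in>{0..1}. hyperbolic l (B t)) \<and>
            (\<exists>j\<in>{1..int l}.
               stable_space l (B 1) j \<noteq> {0} \<and> unstable_space l (B 1) j \<noteq> {0} \<and>
               subspace_angle (stable_space l (B 1) j) (unstable_space l (B 1) j) < \<epsilon>)))"
proof -
  define \<epsilon>' where "\<epsilon>' = min \<epsilon> 1"
  have \<epsilon>': "0 < \<epsilon>'" "\<epsilon>' \<le> 1" "\<epsilon>' \<le> \<epsilon>" using assms(2) by (auto simp: \<epsilon>'_def)
  \<comment> \<open>If all angles are at least \<open>\<epsilon>'\<close>, then \<open>1 / s\<close> bounds the projections of the splitting.\<close>
  define s where "s = sin \<epsilon>'"
  have s: "0 < s" "s \<le> 1" using \<epsilon>' pi_gt3 by (auto simp: s_def intro!: sin_gt_zero)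
  \<comment> \<open>A change of a factor by \<open>\<delta>\<close> changes its inverse by at most \<open>C\<^sup>2 \<delta> < \<epsilon>'\<close>; a slope above
    \<open>\<kappa>\<close> forces an angle below \<open>\<epsilon>'\<close>.\<close>
  define \<delta> where "\<delta> = \<epsilon>' / (2 * C\<^sup>2)"
  define \<kappa> where "\<kappa> = 2 / (s * (1 - cos \<epsilon>'))"
  define K where "K = 16 * C * \<kappa> / \<delta>"
  have \<delta>: "0 < \<delta>" using \<epsilon>'(1) assms(1) by (simp add: \<delta>_def)
  \<comment> \<open>Half the length of the window on which the tent-shaped weight lifts the orbit above \<open>\<kappa>\<close>. The
    window has to fit both into the time span without domination and into the period; the second
    term in the maximum \<open>T\<close> makes one step of the phase small.\<close>
  define r where "r = Suc (nat \<lceil>\<kappa> * C * K\<^sup>2 / (\<delta> * (s\<^sup>2 / 4))\<rceil>)"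
  have r: "0 < r" "\<kappa> * C * K\<^sup>2 < \<delta> * (s\<^sup>2 / 4) * real r"
  proof -
    have "\<kappa> * C * K\<^sup>2 / (\<delta> * (s\<^sup>2 / 4)) < real r" unfolding r_def by linarith
    then show "\<kappa> * C * K\<^sup>2 < \<delta> * (s\<^sup>2 / 4) * real r"
      using \<delta> s by (simp add: pos_divide_less_eq mult.commute)
  qed (simp add: r_def)
  define T where "T = max (2 * r) (nat \<lceil>16 * pi * C * \<kappa> / \<delta>\<rceil>)"
  have "reaches_small_angle G \<epsilon> l A"
    if G: "admissible_group G" and A: "periodic_cocycle G l A" "hyperbolic l A" "bounded_by C A"
      and l: "l \<ge> T" and nontrivial: "\<forall>i. stable_space l A i \<noteq> {0} \<and> unstable_space l A i \<noteq> {0}"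
      and nondom: "\<not> dominated_splitting (2 * r) A (stable_space l A) (unstable_space l A)"
    for G :: "(real^'n^'n) set" and l A
  proof -
    let ?E = "stable_space l A" and ?U = "unstable_space l A"
    obtain \<g> :: "(real^'n^'n) set" where \<g>: "\<forall>M\<in>G. invertible M" "\<forall>M\<in>G. \<forall>N\<in>G. M ** N \<in> G" "subspace \<g>"
      "\<forall>X\<in>\<g>. X ** X = 0 \<longrightarrow> mat 1 + X \<in> G"
      "\<forall>X\<in>\<g>. \<forall>M\<in>G. invertible M \<longrightarrow> M ** X ** matrix_inv M \<in> \<g>"
      and survive: "\<And>l A s i u v n. hyperbolic_cocycle l A \<Longrightarrow> \<forall>i. A i \<in> G \<Longrightarrow> 0 < s \<Longrightarrow> s \<le> 1 \<Longrightarrow>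
       (\<forall>x\<in>stable_space l A i. \<forall>w\<in>unstable_space l A i. s * norm w \<le> norm (x + w) \<and> s * norm x \<le> norm (x + w)) \<Longrightarrow>
       u \<in> stable_space l A i \<Longrightarrow> v \<in> unstable_space l A i \<Longrightarrow> norm u = 1 \<Longrightarrow> norm v = 1 \<Longrightarrow>
       norm (cocycle_prod A i n *v v) \<le> 2 * norm (cocycle_prod A i n *v u) \<Longrightarrow>
       (\<exists>X\<in>hyperbolic_cocycle.triangular l A i \<inter> \<g>. X \<noteq> 0 \<and>
          s\<^sup>2 / 4 * op_norm X \<le> op_norm (hyperbolic_cocycle.transport A i X n))"
      using admissible_group_tangent[OF G] by (elim exE conjE) blast
    interpret group_cocycle l A G \<g> C
    proof unfold_locales
      show "1 \<le> l" "A (i + int l) = A i" "invertible (A i)" "A i \<in> G" for i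
        using A(1) \<g>(1) by (auto simp: periodic_cocycle_def)
      show "op_norm (A i) \<le> C" "op_norm (matrix_inv (A i)) \<le> C" for i
        using A(3) by (auto simp: bounded_by_def)
    qed (use \<g> A(2) assms(1) in auto)
    show ?thesis
    proof (cases "\<exists>j\<in>{1..int l}. subspace_angle (?E j) (?U j) < \<epsilon>'")
      case True
      then obtain j where "j \<in> {1..int l}" "subspace_angle (?E j) (?U j) < \<epsilon>" using \<epsilon>'(3) by force
      then show ?thesis
        using nontrivial by (intro constant_path_reaches_small_angle[OF A(1,2) assms(2)]) auto
    next
      case False
      have angle: "\<epsilon>' \<le> subspace_angle (?E i) (?U i)" for i
      proof -
        let ?j = "(i - 1) mod int l + 1"
        have "(i - 1) mod int l < int l" "0 \<le> (i - 1) mod int l" using l_pos by simp_all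
        then have "?j \<in> {1..int l}" unfolding atLeastAtMost_iff by linarith
        moreover have "i - ?j = (i - 1) - (i - 1) mod int l" by simp
        then have "int l dvd i - ?j" by (simp only: dvd_minus_mod)
        then have "?E i = ?E ?j" "?U i = ?U ?j"
          by (rule periodic_congruent[where l = l, rotated]; simp add: E_periodic U_periodic)+
        ultimately show ?thesis using False by (simp add: not_less)
      qed
      have transversal: "s * norm w \<le> norm (x + w)" "s * norm x \<le> norm (x + w)"
        if "x \<in> ?E i" "w \<in> ?U i" for i x w
        using transversal_if_angle_ge[OF subspace_E \<epsilon>'(1,2) angle that] by (simp_all add: s_def)
      obtain i n u v where uv: "2 * r \<le> n" "u \<in> ?E i" "v \<in> ?U i" "norm u = 1" "norm v = 1"
        "norm (cocycle_prod A i n *v v) \<le> 2 * norm (cocycle_prod A i n *v u)"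
        using vectors_violating_domination[OF hyperbolic_cocycle_axioms _ nondom] nontrivial by blast
      obtain X where X: "X \<in> tangent i" "X \<noteq> 0" "s\<^sup>2 / 4 * op_norm X \<le> op_norm (transport i X n)"
        using survive[OF hyperbolic_cocycle_axioms _ s _ uv(2-6)] in_G transversal
        unfolding tangent_def by blast
      have "16 * pi * C * \<kappa> \<le> \<delta> * real l"
      proof -
        have "16 * pi * C * \<kappa> / \<delta> \<le> real T" unfolding T_def by linarith
        also have "\<dots> \<le> real l" using l by simp
        finally show ?thesis using \<delta> by (simp add: pos_divide_le_eq mult.commute)
      qed
      moreover have "2 * r \<le> l" using l by (simp add: T_def)
      ultimately have "reaches_small_angle G \<epsilon>' l A"
        using reaches_small_angle_if_orbit_survives[OF \<epsilon>'(1,2) s(1) transversal(1) \<delta>_def \<kappa>_def K_def _ _ r _ X(1,2) uv(1) X(3)] s(1)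
        by simp
      then show ?thesis using \<epsilon>'(3) by (rule reaches_small_angle_mono)
    qed
  qed
  then show ?thesis
    unfolding reaches_small_angle_def
    using r(1) by (intro exI[of _ T] exI[of _ "2 * r"]) (auto simp: T_def)
qed

end
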